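(* For every integer $t\ge 1$ there exists a constant $c_t$, depending only on $t$, such that the following holds for every $\epsilon>0$ and every positive integer $n$. Let $F$ be a simple family of $n$ $t$-monotone curves in the plane with at least $\epsilon n^2$ disjoint (unordered) pairs. Then there exist two subfamilies $F_1,F_2\subset F$ such that $|F_1|,|F_2|\ge \epsilon^{c_t} n$ and every curve in $F_1$ is disjoint from every curve in $F_2$.
   Context: A curve in the plane is the image of a smooth injective function $f:I\to\mathbb{R}^2$ whose domain is a closed (bounded) interval $I\subset\mathbb{R}$; smooth is understood as regular (nowhere vanishing derivative), so that the curve has a tangent line at each point. The two images of the endpoints of $I$ are the endpoints of the curve, and the remaining points form its interior. For an integer $t\ge 1$, a curve is $t$-monotone if its interior has at most $t-1$ points at which the tangent is vertical. A family $F$ of curves is simple if any two distinct members intersect in at most one point and no two curves are tangent, i.e., if two curves have a common interior point, they must properly cross at that point. Two curves are disjoint if they have no point in common. *)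

theory Defs
  imports "HOL-Analysis.Analysis"
begin

text \<open>
  The plane is \<^typ>\<open>real \<times> real\<close>. Smoothness is continuous differentiability on the closed
  interval, with one-sided derivatives at its endpoints, and a nowhere vanishing derivative.
\<close>

definition regular_param :: "(real \<Rightarrow> real \<times> real) \<Rightarrow> real \<Rightarrow> real \<Rightarrow> bool" where
  "regular_param f a b \<longleftrightarrow> a < b \<and> inj_on f {a..b} \<and>
     (\<exists>f'. continuous_on {a..b} f' \<and>
        (\<forall>s\<in>{a..b}. (f has_vector_derivative f' s) (at s within {a..b}) \<and> f' s \<noteq> 0))"

definition param_of :: "(real \<Rightarrow> real \<times> real) \<Rightarrow> real \<Rightarrow> real \<Rightarrow> (real \<times> real) set \<Rightarrow> bool" where
  "param_of f a b C \<longleftrightarrow> regular_param f a b \<and> f ` {a..b} = C"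

definition is_curve :: "(real \<times> real) set \<Rightarrow> bool" where
  "is_curve C \<longleftrightarrow> (\<exists>f a b. param_of f a b C)"

text \<open>
  A curve is a point set. Its endpoints and its tangent lines do not depend on the choice of
  the regular parametrization, so the existential quantifiers below merely select one.
\<close>

definition curve_endpoints :: "(real \<times> real) set \<Rightarrow> (real \<times> real) set" where
  "curve_endpoints C = {p. \<exists>f a b. param_of f a b C \<and> (p = f a \<or> p = f b)}"

definition curve_interior :: "(real \<times> real) set \<Rightarrow> (real \<times> real) set" where
  "curve_interior C = C - curve_endpoints C"

definition vertical_tangent_at :: "(real \<times> real) set \<Rightarrow> real \<times> real \<Rightarrow> bool" where
  "vertical_tangent_at C p \<longleftrightarrow>
     (\<exists>f a b s. param_of f a b C \<and> s \<in> {a..b} \<and> f s = p \<and>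
        fst (vector_derivative f (at s within {a..b})) = 0)"

definition t_monotone :: "nat \<Rightarrow> (real \<times> real) set \<Rightarrow> bool" where
  "t_monotone t C \<longleftrightarrow> is_curve C \<and>
     finite {p \<in> curve_interior C. vertical_tangent_at C p} \<and>
     card {p \<in> curve_interior C. vertical_tangent_at C p} \<le> t - 1"

text \<open>
  Proper crossing is topological: near \<open>p\<close> the two curves look like the two coordinate axes,
  up to a homeomorphism of a neighbourhood of \<open>p\<close> onto the plane. Curves with distinct
  tangent lines at a common interior point cross properly there; curves that merely touch
  do not.
\<close>

definition properly_cross_at ::
    "(real \<times> real) set \<Rightarrow> (real \<times> real) set \<Rightarrow> real \<times> real \<Rightarrow> bool" where
  "properly_cross_at A B p \<longleftrightarrow>
     (\<exists>U h k. open U \<and> p \<in> U \<and> homeomorphism U (UNIV :: (real \<times> real) set) h k \<and>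
        h p = (0, 0) \<and> h ` (A \<inter> U) = UNIV \<times> {0} \<and> h ` (B \<inter> U) = {0} \<times> UNIV)"

definition simple_family :: "(real \<times> real) set set \<Rightarrow> bool" where
  "simple_family F \<longleftrightarrow>
     (\<forall>A\<in>F. \<forall>B\<in>F. A \<noteq> B \<longrightarrow>
        (\<forall>p\<in>A \<inter> B. \<forall>q\<in>A \<inter> B. p = q) \<and>
        (\<forall>p\<in>curve_interior A \<inter> curve_interior B. properly_cross_at A B p))"

definition disjoint_pairs :: "'a set set \<Rightarrow> 'a set set set" where
  "disjoint_pairs F = {{A, B} | A B. A \<in> F \<and> B \<in> F \<and> A \<noteq> B \<and> A \<inter> B = {}}"

end

theory Submission imports Defs begin

text \<open>
  Call a relation \<open>D\<close> between \<open>A\<close> and \<open>B\<close> certifiable if it compresses in the following sense: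
  whenever \<open>a\<close> is \<open>D\<close>-related to all of \<open>S\<close>, boundedly many elements of \<open>S\<close> (together with boundedly
  many choices) determine a set \<open>X\<close>, a cell, that contains \<open>a\<close> and all of whose elements in \<open>A\<close> are
  again \<open>D\<close>-related to all of \<open>S\<close>. The theorem follows from two facts: certifiable dense relations
  contain large bicliques, and disjointness in a simple family of \<open>t\<close>-monotone curves is certifiable
  with bounds that depend on \<open>t\<close> only.

  The first fact (\<open>certifiable_dense_imp_biclique\<close>) is a sampling argument. Take \<open>s\<close> random elements of
  \<open>B\<close>, where \<open>s\<close> depends on the certification bounds only. A curve \<open>a\<close> of large \<open>D\<close>-degree has the
  whole sample inside its neighbourhood \<open>N a\<close> with probability polynomial in \<open>\<epsilon>\<close>. If this
  happens, then with probability at least \<open>1/2\<close> the cell of \<open>a\<close> certified by the sample is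
  \<open>D\<close>-complete not only to the sample but to a quarter of \<open>N a\<close> (\<open>half_of_samples_good\<close>). So some
  sample works for many \<open>a\<close> simultaneously; as it has boundedly many cells, one cell contains many
  of them, and this cell is one side of the biclique.

  For the second fact, cut every curve at its vertical tangents into at most \<open>t\<close> graphs of continuous
  functions over intervals (\<open>t_monotone_pieces\<close>). Certifiable relations are closed under finite
  conjunctions and disjunctions, so it suffices to treat one fixed pair of piece indices. Because
  curves meet at most once and then cross, the difference of pieces of two curves changes sign at
  most once (\<open>pieces_cross_once\<close>). Hence a piece lies below another one on their common interval iff it
  does so at both ends of that interval. Each end is an endpoint of one of the two pieces, and so
  disjointness becomes a Boolean combination of comparisons of interval endpoints and of relations
  ``a point lies above an arc'', in which either the points or the arcs are to be compressed.
  If arcs are compressed, the cell is the one of the vertical decomposition: the lowest arc over the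
  point, and a bound on either side up to which no other arc gets below it. If points are compressed, the
  same works in the dual arrangement, in which arcs are ordered by their height at a common
  abscissa and points become pseudolines (\<open>certifiable_points_above_arcs\<close>).
\<close>

section \<open>Certifiable relations\<close>

text \<open>
  The witnesses \<open>T\<close> are required to lie in \<open>S\<close> itself: this is what lets a random sample of the
  neighbourhood of \<open>a\<close>, used as \<open>S\<close>, produce a cell around \<open>a\<close>. The number \<open>m\<close> accounts for bounded extra
  information beyond \<open>T\<close>, such as the roles that the elements of \<open>T\<close> play.
\<close>

definition certifiable :: "nat \<Rightarrow> nat \<Rightarrow> 'a set \<Rightarrow> 'b set \<Rightarrow> ('a \<Rightarrow> 'b \<Rightarrow> bool) \<Rightarrow> bool" where
  "certifiable m k A B D \<longleftrightarrow>
     (\<exists>cells :: 'b set \<Rightarrow> 'a set set.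
        (\<forall>T. finite T \<and> card T \<le> k \<longrightarrow> finite (cells T) \<and> card (cells T) \<le> m) \<and>
        (\<forall>a\<in>A. \<forall>S\<subseteq>B. (\<forall>b\<in>S. D a b) \<longrightarrow>
           (\<exists>T\<subseteq>S. finite T \<and> card T \<le> k \<and>
              (\<exists>X\<in>cells T. a \<in> X \<and> (\<forall>a'\<in>X \<inter> A. \<forall>b\<in>S. D a' b)))))"

text \<open>
  Passing to all small subsets makes the family of cells monotone in \<open>Y\<close>, so that a superset of a
  witness still offers its cell.
\<close>

definition all_cells :: "nat \<Rightarrow> ('b set \<Rightarrow> 'a set set) \<Rightarrow> 'b set \<Rightarrow> 'a set set" where
  "all_cells k cells Y = (\<Union>T\<in>{T. T \<subseteq> Y \<and> card T \<le> k}. cells T)"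

lemma all_cells_bound:
  assumes "finite Y"
    and "\<And>T. finite T \<Longrightarrow> card T \<le> k \<Longrightarrow> finite (cells T) \<and> card (cells T) \<le> m"
  shows "finite (all_cells k cells Y)" and "card (all_cells k cells Y) \<le> 2 ^ card Y * m"
proof -
  let ?P = "{T. T \<subseteq> Y \<and> card T \<le> k}"
  have sub: "?P \<subseteq> Pow Y" by auto
  have fin: "finite ?P" using sub assms(1) by (meson finite_Pow_iff finite_subset)
  have each: "finite (cells T) \<and> card (cells T) \<le> m" if "T \<in> ?P" for T
    using that assms finite_subset by blast
  show "finite (all_cells k cells Y)"
    unfolding all_cells_def using fin each by blast
  have "card (all_cells k cells Y) \<le> (\<Sum>T\<in>?P. card (cells T))"
    unfolding all_cells_def by (rule card_UN_le[OF fin])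
  also have "\<dots> \<le> (\<Sum>T\<in>?P. m)"
    by (rule sum_mono) (use each in blast)
  also have "\<dots> = card ?P * m" by simp
  also have "\<dots> \<le> card (Pow Y) * m"
    using card_mono[OF _ sub] assms(1) by simp
  finally show "card (all_cells k cells Y) \<le> 2 ^ card Y * m"
    using card_Pow[OF assms(1)] by simp
qed

text \<open>
  The common core of conjunction and disjunction: certify both parts separately and intersect the
  cells. For a conjunction both parts are the whole set; for a disjunction they are the
  elements for which \<open>a\<close> satisfies the first and the second disjunct, and either part may be empty.
\<close>

lemma certifiable_pair:
  assumes "certifiable m1 k1 A B D1" and "certifiable m2 k2 A B D2"
  obtains cells where
    "\<And>T. finite T \<Longrightarrow> card T \<le> k1 + k2 \<Longrightarrow>
       finite (cells T) \<and> card (cells T) \<le> 4 ^ (k1 + k2) * m1 * m2"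
    "\<And>a S1 S2. \<lbrakk>a \<in> A; S1 \<subseteq> B; S2 \<subseteq> B; \<forall>b\<in>S1. D1 a b; \<forall>b\<in>S2. D2 a b\<rbrakk> \<Longrightarrow>
       \<exists>T\<subseteq>S1 \<union> S2. finite T \<and> card T \<le> k1 + k2 \<and>
         (\<exists>X\<in>cells T. a \<in> X \<and>
            (\<forall>a'\<in>X \<inter> A. (\<forall>b\<in>S1. D1 a' b) \<and> (\<forall>b\<in>S2. D2 a' b)))"
proof -
  obtain c1 where c1': "\<forall>T. finite T \<and> card T \<le> k1 \<longrightarrow> finite (c1 T) \<and> card (c1 T) \<le> m1"
    and e1: "\<forall>a\<in>A. \<forall>S\<subseteq>B. (\<forall>b\<in>S. D1 a b) \<longrightarrow>
       (\<exists>T\<subseteq>S. finite T \<and> card T \<le> k1 \<and> (\<exists>X\<in>c1 T. a \<in> X \<and> (\<forall>a'\<in>X \<inter> A. \<forall>b\<in>S. D1 a' b)))"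
    using assms(1) unfolding certifiable_def by (elim exE conjE)
  have c1: "finite (c1 T) \<and> card (c1 T) \<le> m1" if "finite T" "card T \<le> k1" for T
    using c1' that by simp
  obtain c2 where c2': "\<forall>T. finite T \<and> card T \<le> k2 \<longrightarrow> finite (c2 T) \<and> card (c2 T) \<le> m2"
    and e2: "\<forall>a\<in>A. \<forall>S\<subseteq>B. (\<forall>b\<in>S. D2 a b) \<longrightarrow>
       (\<exists>T\<subseteq>S. finite T \<and> card T \<le> k2 \<and> (\<exists>X\<in>c2 T. a \<in> X \<and> (\<forall>a'\<in>X \<inter> A. \<forall>b\<in>S. D2 a' b)))"
    using assms(2) unfolding certifiable_def by (elim exE conjE)
  have c2: "finite (c2 T) \<and> card (c2 T) \<le> m2" if "finite T" "card T \<le> k2" for T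
    using c2' that by simp
  define cells where
    "cells T = (\<lambda>(X, Y). X \<inter> Y) ` (all_cells k1 c1 T \<times> all_cells k2 c2 T)" for T
  show thesis
  proof (rule that[of cells])
    fix T :: "'b set"
    assume T: "finite T" "card T \<le> k1 + k2"
    note b1 = all_cells_bound[where k = k1 and cells = c1, OF T(1) c1]
    note b2 = all_cells_bound[where k = k2 and cells = c2, OF T(1) c2]
    have pow: "(2::nat) ^ card T \<le> 2 ^ (k1 + k2)" using T(2) by simp
    have "card (cells T) \<le> card (all_cells k1 c1 T) * card (all_cells k2 c2 T)"
      unfolding cells_def card_cartesian_product[symmetric]
      using b1(1) b2(1) by (intro card_image_le) auto
    also have "\<dots> \<le> (2 ^ (k1 + k2) * m1) * (2 ^ (k1 + k2) * m2)"
      using b1(2) b2(2) pow by (meson mult_le_mono le_refl order_trans)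
    also have "\<dots> = (2 ^ (k1 + k2) * 2 ^ (k1 + k2)) * m1 * m2"
      by (simp add: mult_ac)
    also have "(2::nat) ^ (k1 + k2) * 2 ^ (k1 + k2) = 4 ^ (k1 + k2)"
      by (simp flip: power_mult_distrib)
    finally show "finite (cells T) \<and> card (cells T) \<le> 4 ^ (k1 + k2) * m1 * m2"
      using b1(1) b2(1) unfolding cells_def by auto
  next
    fix a S1 S2
    assume a: "a \<in> A" "S1 \<subseteq> B" "S2 \<subseteq> B" "\<forall>b\<in>S1. D1 a b" "\<forall>b\<in>S2. D2 a b"
    obtain T1 X1 where 1: "T1 \<subseteq> S1" "finite T1" "card T1 \<le> k1" "X1 \<in> c1 T1" "a \<in> X1"
      "\<forall>a'\<in>X1 \<inter> A. \<forall>b\<in>S1. D1 a' b"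
      using e1[rule_format, OF a(1,2), OF bspec[OF a(4)]] by auto
    obtain T2 X2 where 2: "T2 \<subseteq> S2" "finite T2" "card T2 \<le> k2" "X2 \<in> c2 T2" "a \<in> X2"
      "\<forall>a'\<in>X2 \<inter> A. \<forall>b\<in>S2. D2 a' b"
      using e2[rule_format, OF a(1,3), OF bspec[OF a(5)]] by auto
    have "X1 \<in> all_cells k1 c1 (T1 \<union> T2)" "X2 \<in> all_cells k2 c2 (T1 \<union> T2)"
      unfolding all_cells_def using 1 2 by auto
    then have "X1 \<inter> X2 \<in> cells (T1 \<union> T2)" unfolding cells_def by force
    moreover have "card (T1 \<union> T2) \<le> k1 + k2"
      using card_Un_le[of T1 T2] 1(3) 2(3) by linarith
    ultimately show "\<exists>T\<subseteq>S1 \<union> S2. finite T \<and> card T \<le> k1 + k2 \<and>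
         (\<exists>X\<in>cells T. a \<in> X \<and>
            (\<forall>a'\<in>X \<inter> A. (\<forall>b\<in>S1. D1 a' b) \<and> (\<forall>b\<in>S2. D2 a' b)))"
      using 1 2 by (intro exI[of _ "T1 \<union> T2"] conjI bexI[of _ "X1 \<inter> X2"]) auto
  qed
qed

lemma certifiable_conj:
  assumes "certifiable m1 k1 A B D1" and "certifiable m2 k2 A B D2"
  shows "certifiable (4 ^ (k1 + k2) * m1 * m2) (k1 + k2) A B (\<lambda>a b. D1 a b \<and> D2 a b)"
proof -
  obtain cells where c:
    "\<And>T. finite T \<Longrightarrow> card T \<le> k1 + k2 \<Longrightarrow>
       finite (cells T) \<and> card (cells T) \<le> 4 ^ (k1 + k2) * m1 * m2"
    and e: "\<And>a S1 S2. \<lbrakk>a \<in> A; S1 \<subseteq> B; S2 \<subseteq> B; \<forall>b\<in>S1. D1 a b; \<forall>b\<in>S2. D2 a b\<rbrakk> \<Longrightarrow>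
       \<exists>T\<subseteq>S1 \<union> S2. finite T \<and> card T \<le> k1 + k2 \<and>
         (\<exists>X\<in>cells T. a \<in> X \<and>
            (\<forall>a'\<in>X \<inter> A. (\<forall>b\<in>S1. D1 a' b) \<and> (\<forall>b\<in>S2. D2 a' b)))"
    by (rule certifiable_pair[OF assms]) (rule that; assumption)
  show ?thesis
    unfolding certifiable_def
  proof (intro exI[of _ cells] conjI allI ballI impI)
    fix a S assume "a \<in> A" "S \<subseteq> B" "\<forall>b\<in>S. D1 a b \<and> D2 a b"
    then show "\<exists>T\<subseteq>S. finite T \<and> card T \<le> k1 + k2 \<and>
        (\<exists>X\<in>cells T. a \<in> X \<and> (\<forall>a'\<in>X \<inter> A. \<forall>b\<in>S. D1 a' b \<and> D2 a' b))"
      using e[of a S S] by (simp add: ball_conj_distrib)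
  qed (simp_all add: c)
qed

lemma certifiable_disj:
  assumes "certifiable m1 k1 A B D1" and "certifiable m2 k2 A B D2"
  shows "certifiable (4 ^ (k1 + k2) * m1 * m2) (k1 + k2) A B (\<lambda>a b. D1 a b \<or> D2 a b)"
proof -
  obtain cells where c:
    "\<And>T. finite T \<Longrightarrow> card T \<le> k1 + k2 \<Longrightarrow>
       finite (cells T) \<and> card (cells T) \<le> 4 ^ (k1 + k2) * m1 * m2"
    and e: "\<And>a S1 S2. \<lbrakk>a \<in> A; S1 \<subseteq> B; S2 \<subseteq> B; \<forall>b\<in>S1. D1 a b; \<forall>b\<in>S2. D2 a b\<rbrakk> \<Longrightarrow>
       \<exists>T\<subseteq>S1 \<union> S2. finite T \<and> card T \<le> k1 + k2 \<and>
         (\<exists>X\<in>cells T. a \<in> X \<and>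
            (\<forall>a'\<in>X \<inter> A. (\<forall>b\<in>S1. D1 a' b) \<and> (\<forall>b\<in>S2. D2 a' b)))"
    by (rule certifiable_pair[OF assms]) (rule that; assumption)
  show ?thesis
    unfolding certifiable_def
  proof (intro exI[of _ cells] conjI allI ballI impI)
    fix a S assume a: "a \<in> A" "S \<subseteq> B" "\<forall>b\<in>S. D1 a b \<or> D2 a b"
    let ?S1 = "{b \<in> S. D1 a b}" and ?S2 = "{b \<in> S. D2 a b}"
    have S: "?S1 \<union> ?S2 = S" using a(3) by auto
    have "\<exists>T\<subseteq>?S1 \<union> ?S2. finite T \<and> card T \<le> k1 + k2 \<and>
        (\<exists>X\<in>cells T. a \<in> X \<and>
           (\<forall>a'\<in>X \<inter> A. (\<forall>b\<in>?S1. D1 a' b) \<and> (\<forall>b\<in>?S2. D2 a' b)))"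
      by (rule e) (use a(1,2) in auto)
    then obtain T X where T: "T \<subseteq> S" "finite T" "card T \<le> k1 + k2" "X \<in> cells T" "a \<in> X"
      and X: "\<forall>a'\<in>X \<inter> A. (\<forall>b\<in>?S1. D1 a' b) \<and> (\<forall>b\<in>?S2. D2 a' b)"
      unfolding S by (elim exE bexE conjE)
    from X a(3) have "\<forall>a'\<in>X \<inter> A. \<forall>b\<in>S. D1 a' b \<or> D2 a' b" by blast
    with T show "\<exists>T\<subseteq>S. finite T \<and> card T \<le> k1 + k2 \<and>
        (\<exists>X\<in>cells T. a \<in> X \<and> (\<forall>a'\<in>X \<inter> A. \<forall>b\<in>S. D1 a' b \<or> D2 a' b))"
      by (intro exI[of _ T] conjI bexI[of _ X])
  qed (simp_all add: c)
qed

lemma certifiable_True: "certifiable 1 0 A B (\<lambda>a b. True)"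
  unfolding certifiable_def
  by (rule exI[of _ "\<lambda>_. {UNIV}"], simp, intro ballI allI impI, rule exI[of _ "{}"], simp)

text \<open>
  The bounds are chosen before the relations, since in the end they must not depend on the family of
  curves.
\<close>

lemma certifiable_Ball:
  assumes "finite I"
  shows "\<exists>m' k'. \<forall>(A :: 'a set) (B :: 'b set) D. (\<forall>i\<in>I. certifiable m k A B (D i)) \<longrightarrow>
           certifiable m' k' A B (\<lambda>a b. \<forall>i\<in>I. D i a b)"
  using assms
proof (induction I rule: finite_induct)
  case empty
  show ?case 
    by (rule exI[of _ 1], rule exI[of _ 0]) (simp add: certifiable_True[unfolded One_nat_def])
next
  case (insert i I)
  from insert.IH obtain m' k' where IH: "\<forall>(A :: 'a set) (B :: 'b set) D. (\<forall>i\<in>I. certifiable m k A B (D i)) \<longrightarrow>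
           certifiable m' k' A B (\<lambda>a b. \<forall>i\<in>I. D i a b)"
    by blast
  have "certifiable (4 ^ (k + k') * m * m') (k + k') A B (\<lambda>a b. \<forall>j\<in>insert i I. D j a b)"
    if "\<forall>j\<in>insert i I. certifiable m k A B (D j)"
    for A :: "'a set" and B :: "'b set" and D
  proof -
    have "certifiable m' k' A B (\<lambda>a b. \<forall>i\<in>I. D i a b)" using IH that by simp
    from certifiable_conj[OF _ this, of m k "D i"] that show ?thesis by simp
  qed
  then show ?case
    by - (rule exI[where x = "4 ^ (k + k') * m * m'"], rule exI[where x = "k + k'"], intro allI impI)
qed

text \<open>
  In applications the witnesses come with roles, hence as a tuple. Forgetting the order costs a factor
  \<open>n ^ n\<close>, and one more cell, the whole type, serves the empty set.
\<close>

lemma certifiable_from_tuples: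
  assumes "finite B"
    and tup: "\<And>a S. \<lbrakk>a \<in> A; S \<subseteq> B; finite S; S \<noteq> {}; \<forall>b\<in>S. D a b\<rbrakk> \<Longrightarrow>
      \<exists>xs. set xs \<subseteq> S \<and> length xs = n \<and> a \<in> cell xs \<and> (\<forall>a'\<in>cell xs \<inter> A. \<forall>b\<in>S. D a' b)"
  shows "certifiable (Suc (n ^ n)) n A B D"
proof -
  define cells where "cells T = insert UNIV (cell ` {xs. set xs \<subseteq> T \<and> length xs = n})" for T
  show ?thesis
    unfolding certifiable_def
  proof (intro exI[of _ cells] conjI allI ballI impI)
    fix T :: "'a set" assume T: "finite T \<and> card T \<le> n"
    then have fin: "finite {xs. set xs \<subseteq> T \<and> length xs = n}"
      by (simp add: finite_lists_length_eq)
    then show "finite (cells T)" unfolding cells_def by simp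
    have "card (cells T) \<le> Suc (card (cell ` {xs. set xs \<subseteq> T \<and> length xs = n}))"
      unfolding cells_def by (simp add: card_insert_if fin)
    also have "\<dots> \<le> Suc (card T ^ n)"
      using card_image_le[OF fin, of cell] card_lists_length_eq[of T n] T by simp
    also have "\<dots> \<le> Suc (n ^ n)" using T by (simp add: power_mono)
    finally show "card (cells T) \<le> Suc (n ^ n)" .
  next
    fix a S assume a: "a \<in> A" "S \<subseteq> B" "\<forall>b\<in>S. D a b"
    show "\<exists>T\<subseteq>S. finite T \<and> card T \<le> n \<and>
        (\<exists>X\<in>cells T. a \<in> X \<and> (\<forall>a'\<in>X \<inter> A. \<forall>b\<in>S. D a' b))"
    proof (cases "S = {}")
      case True
      then show ?thesis unfolding cells_def by (intro exI[of _ "{}"]) simp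
    next
      case False
      then obtain xs where xs: "set xs \<subseteq> S" "length xs = n" "a \<in> cell xs"
        "\<forall>a'\<in>cell xs \<inter> A. \<forall>b\<in>S. D a' b"
        using tup[OF a(1,2) _ False a(3)] finite_subset[OF a(2) assms(1)] by blast
      have "card (set xs) \<le> n" using card_length[of xs] xs(2) by simp
      moreover have "cell xs \<in> cells (set xs)" unfolding cells_def using xs(2) by auto
      ultimately show ?thesis using xs by (intro exI[of _ "set xs"] conjI bexI[of _ "cell xs"]) auto
    qed
  qed
qed

section \<open>Large bicliques in dense certifiable relations\<close>

text \<open>
  Once the entries of a sample at positions \<open>J\<close> are chosen, each remaining entry is confined to one
  of at most \<open>M\<close> sets that contain at most a quarter of \<open>D\<close>; every such entry saves a factor 4.
\<close>

lemma card_confined_samples: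
  assumes fin: "finite I" "finite D" and J: "J \<subseteq> I"
    and G: "\<And>f. f \<in> G \<Longrightarrow> f \<in> I \<rightarrow>\<^sub>E D \<and>
              (\<exists>X\<in>V (restrict f J). f ` (I - J) \<subseteq> OK X)"
    and V: "\<And>g. g \<in> J \<rightarrow>\<^sub>E D \<Longrightarrow> finite (V g) \<and> card (V g) \<le> M"
    and OK: "\<And>g X. g \<in> J \<rightarrow>\<^sub>E D \<Longrightarrow> X \<in> V g \<Longrightarrow> finite (OK X) \<and> card (OK X) * 4 \<le> card D"
  shows "4 ^ (card I - card J) * card G \<le> M * card D ^ card I"
proof -
  let ?r = "card I - card J"
  have finJ: "finite J" using J fin finite_subset by blast
  have r: "card (I - J) = ?r" using J finJ by (simp add: card_Diff_subset)
  define H where "H g = (\<Union>X\<in>V g. (I - J) \<rightarrow>\<^sub>E OK X)" for g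
  have finFun: "finite (J \<rightarrow>\<^sub>E D)" using finJ fin(2) by (rule finite_PiE)
  have finH: "finite (H g)" if "g \<in> J \<rightarrow>\<^sub>E D" for g
    unfolding H_def using V[OF that] OK[OF that] fin(1) by (auto intro!: finite_PiE)
  have cardH: "4 ^ ?r * card (H g) \<le> M * card D ^ ?r" if g: "g \<in> J \<rightarrow>\<^sub>E D" for g
  proof -
    have "card (H g) \<le> (\<Sum>X\<in>V g. card ((I - J) \<rightarrow>\<^sub>E OK X))"
      unfolding H_def using V[OF g] by (intro card_UN_le) auto
    also have "\<dots> = (\<Sum>X\<in>V g. card (OK X) ^ ?r)"
      using fin(1) r by (simp add: card_PiE)
    finally have "4 ^ ?r * card (H g) \<le> 4 ^ ?r * (\<Sum>X\<in>V g. card (OK X) ^ ?r)"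
      by (rule mult_left_mono) simp
    also have "\<dots> = (\<Sum>X\<in>V g. (card (OK X) * 4) ^ ?r)"
      by (simp add: power_mult_distrib sum_distrib_left mult.commute)
    also have "\<dots> \<le> (\<Sum>X\<in>V g. card D ^ ?r)"
      by (intro sum_mono power_mono) (use OK[OF g] in auto)
    also have "\<dots> \<le> M * card D ^ ?r" using V[OF g] by simp
    finally show ?thesis .
  qed
  let ?split = "\<lambda>f. (restrict f J, restrict f (I - J))"
  have inj: "inj_on ?split G"
  proof (rule inj_onI)
    fix f h assume f: "f \<in> G" and h: "h \<in> G" and eq: "?split f = ?split h"
    show "f = h"
    proof
      fix x
      have "f x = h x" if "x \<in> J" using eq that by (metis prod.inject restrict_apply')
      moreover have "f x = h x" if "x \<in> I - J" using eq that by (metis prod.inject restrict_apply')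
      moreover have "f x = h x" if "x \<notin> I"
        using G[OF f] G[OF h] that by (metis PiE_arb)
      ultimately show "f x = h x" by blast
    qed
  qed
  have "?split ` G \<subseteq> Sigma (J \<rightarrow>\<^sub>E D) H"
  proof
    fix y assume "y \<in> ?split ` G"
    then obtain f where f: "f \<in> G" "y = ?split f" by blast
    obtain X where X: "X \<in> V (restrict f J)" "f ` (I - J) \<subseteq> OK X" "f \<in> I \<rightarrow>\<^sub>E D"
      using G[OF f(1)] by blast
    have "restrict f J \<in> J \<rightarrow>\<^sub>E D" using X(3) J by auto
    moreover have "restrict f (I - J) \<in> (I - J) \<rightarrow>\<^sub>E OK X" using X(2) by auto
    ultimately show "y \<in> Sigma (J \<rightarrow>\<^sub>E D) H" unfolding H_def f(2) using X(1) by auto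
  qed
  then have "card G \<le> card (Sigma (J \<rightarrow>\<^sub>E D) H)"
    using card_inj_on_le[OF inj] finFun finH by (meson finite_SigmaI)
  also have "\<dots> = (\<Sum>g\<in>J \<rightarrow>\<^sub>E D. card (H g))"
    using finFun finH by (intro card_SigmaI) auto
  finally have "4 ^ ?r * card G \<le> 4 ^ ?r * (\<Sum>g\<in>J \<rightarrow>\<^sub>E D. card (H g))"
    by (rule mult_left_mono) simp
  also have "\<dots> = (\<Sum>g\<in>J \<rightarrow>\<^sub>E D. 4 ^ ?r * card (H g))"
    by (rule sum_distrib_left)
  also have "\<dots> \<le> (\<Sum>g\<in>J \<rightarrow>\<^sub>E D. M * card D ^ ?r)"
    by (intro sum_mono cardH)
  also have "\<dots> = M * (card D ^ card J * card D ^ ?r)"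
    using finJ by (simp add: card_PiE)
  also have "\<dots> = M * card D ^ card I"
    using card_mono[OF fin(1) J] by (simp flip: power_add)
  finally show ?thesis .
qed

text \<open>
  The set \<open>OK X\<close> stands for those elements of \<open>D\<close> that are related to the whole cell \<open>X\<close>. A sample that
  is not good still has a certificate \<open>T\<close>, which uses at most \<open>k\<close> of its positions; all other entries then
  lie in the set \<open>OK X\<close> of the certified cell, although this set contains less than a quarter of \<open>D\<close>. There
  are at most \<open>2 ^ s\<close> sets of positions for \<open>T\<close> and at most \<open>2 ^ k * m\<close> cells, so such
  samples make up at most a fraction \<open>2 ^ s * (2 ^ k * m) / 4 ^ (s - k)\<close> of all, and the
  sample size \<open>s = m + 3 * k + 1\<close> brings this below \<open>1/2\<close>.
\<close>

lemma half_of_samples_good: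
  fixes cells :: "'b set \<Rightarrow> 'a set set"
  assumes finD: "finite D" and I: "finite I" "card I = m + 3 * k + 1"
    and cells: "\<And>T. finite T \<Longrightarrow> card T \<le> k \<Longrightarrow> finite (cells T) \<and> card (cells T) \<le> m"
    and OKD: "\<And>X. OK X \<subseteq> D"
    and cert: "\<And>S. S \<subseteq> D \<Longrightarrow> \<exists>T\<subseteq>S. finite T \<and> card T \<le> k \<and> (\<exists>X\<in>cells T. P X \<and> S \<subseteq> OK X)"
  shows "card D ^ card I \<le>
    2 * card {f \<in> I \<rightarrow>\<^sub>E D. \<exists>X\<in>all_cells k cells (f ` I). P X \<and> card D \<le> 4 * card (OK X)}"
    (is "_ \<le> 2 * card ?Good")
proof -
  let ?F = "I \<rightarrow>\<^sub>E D"
  let ?s = "card I"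
  have finF: "finite ?F" using I(1) finD by (rule finite_PiE)
  have finOK: "finite (OK X)" for X using OKD finD finite_subset by blast
  let ?V = "\<lambda>J g. {X \<in> all_cells k cells (g ` J). 4 * card (OK X) \<le> card D}"
  define G where "G J = {f \<in> ?F. \<exists>X\<in>?V J (restrict f J). f ` (I - J) \<subseteq> OK X}" for J
  have cardG: "4 ^ (?s - k) * card (G J) \<le> 2 ^ k * m * card D ^ ?s"
    if J: "J \<subseteq> I" "card J \<le> k" for J
  proof -
    have finJ: "finite J" using J I finite_subset by blast
    have V: "finite (?V J g) \<and> card (?V J g) \<le> 2 ^ k * m" for g :: "'c \<Rightarrow> 'b"
    proof -
      have "finite (g ` J)" using finJ by simp
      note bnd = all_cells_bound[OF this, of k cells m, OF cells]
      have "card (?V J g) \<le> card (all_cells k cells (g ` J))"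
        using bnd(1) by (intro card_mono) auto
      also have "\<dots> \<le> 2 ^ card (g ` J) * m" by (rule bnd(2))
      also have "\<dots> \<le> 2 ^ k * m"
        using card_image_le[OF finJ, of g] J(2) by simp
      finally show ?thesis using bnd(1) by simp
    qed
    have "4 ^ (?s - card J) * card (G J) \<le> (2 ^ k * m) * card D ^ ?s"
    proof (rule card_confined_samples[OF I(1) finD J(1), where V = "?V J" and OK = OK])
      show "finite (?V J g) \<and> card (?V J g) \<le> 2 ^ k * m" for g by (rule V)
    qed (use finOK in \<open>auto simp: G_def mult.commute\<close>)
    moreover have "(4::nat) ^ (?s - k) * card (G J) \<le> 4 ^ (?s - card J) * card (G J)"
      using J(2) by (intro mult_right_mono power_increasing) auto
    ultimately show ?thesis by linarith
  qed
  let ?Js = "{J. J \<subseteq> I \<and> card J \<le> k}"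
  have Js: "?Js \<subseteq> Pow I" by auto
  have finJs: "finite ?Js" using Js I(1) by (meson finite_Pow_iff finite_subset)
  have cardJs: "card ?Js \<le> 2 ^ ?s" using card_mono[OF _ Js] I(1) by (simp add: card_Pow)
  have bad: "?F - ?Good \<subseteq> (\<Union>J\<in>?Js. G J)"
  proof
    fix f assume f: "f \<in> ?F - ?Good"
    have "f ` I \<subseteq> D" using f by auto
    from cert[OF this] obtain T X where T: "T \<subseteq> f ` I" "finite T" "card T \<le> k"
      and X: "X \<in> cells T" "P X" "f ` I \<subseteq> OK X" by blast
    obtain J where J: "J \<subseteq> I" "inj_on f J" "T = f ` J"
      using T(1) by (meson subset_image_inj)
    have "card J \<le> k" using J T(3) by (simp add: card_image)
    moreover have "X \<in> all_cells k cells (f ` I)" "X \<in> all_cells k cells (f ` J)"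
      unfolding all_cells_def using T X J by auto
    moreover from this(1) have "\<not> card D \<le> 4 * card (OK X)" using f X(2) by blast
    moreover have "restrict f J ` J = f ` J" by simp
    moreover have "f ` (I - J) \<subseteq> OK X" using X(3) by blast
    ultimately have "X \<in> ?V J (restrict f J) \<and> f ` (I - J) \<subseteq> OK X" by simp
    then have "f \<in> G J" unfolding G_def using f by blast
    then show "f \<in> (\<Union>J\<in>?Js. G J)" using J(1) \<open>card J \<le> k\<close> by blast
  qed
  have "card (?F - ?Good) \<le> card (\<Union>J\<in>?Js. G J)"
    by (intro card_mono bad finite_UN_I finJs finite_subset[OF _ finF]) (auto simp: G_def)
  also have "\<dots> \<le> (\<Sum>J\<in>?Js. card (G J))" by (rule card_UN_le[OF finJs])
  finally have "4 ^ (?s - k) * card (?F - ?Good) \<le> 4 ^ (?s - k) * (\<Sum>J\<in>?Js. card (G J))"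
    by (rule mult_left_mono) simp
  also have "\<dots> = (\<Sum>J\<in>?Js. 4 ^ (?s - k) * card (G J))"
    by (rule sum_distrib_left)
  also have "\<dots> \<le> (\<Sum>J\<in>?Js. 2 ^ k * m * card D ^ ?s)"
    by (intro sum_mono cardG) auto
  also have "\<dots> \<le> 2 ^ ?s * (2 ^ k * m * card D ^ ?s)"
    using cardJs by simp
  also have "\<dots> \<le> 2 ^ ?s * (2 ^ k * 2 ^ m * card D ^ ?s)"
    by (intro mult_left_mono mult_right_mono) (auto simp: less_imp_le)
  finally have *: "4 ^ (?s - k) * card (?F - ?Good) \<le> 2 ^ ?s * (2 ^ k * 2 ^ m * card D ^ ?s)" .
  have "(4::nat) ^ (?s - k) = 2 ^ (2 * (?s - k))" by (simp add: power_mult)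
  also have "2 * (?s - k) = ?s + k + m + 1" using I(2) by simp
  finally have "2 ^ (?s + k + m) * (2 * card (?F - ?Good)) \<le> 2 ^ (?s + k + m) * card D ^ ?s"
    using * by (simp add: power_add mult_ac)
  then have "2 * card (?F - ?Good) \<le> card D ^ ?s" by simp
  moreover have "card ?F = card (?F - ?Good) + card ?Good"
    using finF by (subst card_Diff_subset) (auto intro: card_mono finite_subset simp: card_mono)
  moreover have "card ?F = card D ^ ?s" using I(1) by (simp add: card_PiE)
  ultimately show ?thesis by linarith
qed

text \<open>
  Double counting of the pairs \<open>(a, f)\<close> related by \<open>g\<close>.
\<close>

lemma large_fibre:
  fixes g :: "'a \<Rightarrow> 'b \<Rightarrow> bool" and c :: real
  assumes "finite P" "finite Q" "Q \<noteq> {}"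
    and "\<And>a. a \<in> P \<Longrightarrow> c * card Q \<le> card {f \<in> Q. g a f}"
  obtains f where "f \<in> Q" "c * card P \<le> card {a \<in> P. g a f}"
proof -
  have "(\<Sum>f\<in>Q. c * card P) = (\<Sum>a\<in>P. c * card Q)" by simp
  also have "\<dots> \<le> (\<Sum>a\<in>P. real (card {f \<in> Q. g a f}))"
    by (intro sum_mono assms(4))
  also have "\<dots> = real (card (SIGMA a:P. {f \<in> Q. g a f}))"
    using assms by (simp add: card_SigmaI)
  also have "card (SIGMA a:P. {f \<in> Q. g a f}) = card (SIGMA f:Q. {a \<in> P. g a f})"
    by (rule bij_betw_same_card[of prod.swap]) (auto simp: bij_betw_def inj_on_def image_iff)
  also have "real \<dots> = (\<Sum>f\<in>Q. real (card {a \<in> P. g a f}))"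
    using assms by (simp add: card_SigmaI)
  finally have sum: "(\<Sum>f\<in>Q. c * card P) \<le> (\<Sum>f\<in>Q. real (card {a \<in> P. g a f}))" .
  have "\<exists>f\<in>Q. c * card P \<le> card {a \<in> P. g a f}"
  proof (rule ccontr)
    assume "\<not> ?thesis"
    then have "(\<Sum>f\<in>Q. real (card {a \<in> P. g a f})) < (\<Sum>f\<in>Q. c * card P)"
      using assms by (intro sum_strict_mono) auto
    with sum show False by linarith
  qed
  with that show thesis by blast
qed

text \<open>
  At least \<open>\<delta> / 2 * card A\<close> elements of \<open>A\<close> have degree at least \<open>\<delta> / 2 * card B\<close>. For each of
  them a fraction of at least \<open>(\<delta> / 2) ^ s / 2\<close> of the samples of size \<open>s\<close> lies inside the
  neighbourhood and is good, so one sample is good for that fraction of these elements; it has at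
  most \<open>2 ^ (s + m)\<close> cells.
\<close>

lemma certifiable_dense_imp_biclique:
  fixes \<delta> :: real
  assumes fin: "finite A" "finite B" and ne: "A \<noteq> {}" "B \<noteq> {}"
    and cert: "certifiable m k A B D" and "\<delta> > 0"
    and dense: "\<delta> * card A * card B \<le> card {(a, b). a \<in> A \<and> b \<in> B \<and> D a b}"
    and s: "s = m + 3 * k + 1"
  obtains A' B' where "A' \<subseteq> A" "B' \<subseteq> B" "\<forall>a\<in>A'. \<forall>b\<in>B'. D a b"
    "(\<delta> / 2) ^ (s + 1) / 2 ^ (s + m + 1) * card A \<le> card A'"
    "\<delta> / 8 * card B \<le> card B'"
proof -
  obtain cells where cells': "\<forall>T. finite T \<and> card T \<le> k \<longrightarrow> finite (cells T) \<and> card (cells T) \<le> m"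
    and ex: "\<forall>a\<in>A. \<forall>S\<subseteq>B. (\<forall>b\<in>S. D a b) \<longrightarrow>
       (\<exists>T\<subseteq>S. finite T \<and> card T \<le> k \<and>
          (\<exists>X\<in>cells T. a \<in> X \<and> (\<forall>a'\<in>X \<inter> A. \<forall>b\<in>S. D a' b)))"
    using cert unfolding certifiable_def by (elim exE conjE)
  have cells: "finite (cells T) \<and> card (cells T) \<le> m" if "finite T" "card T \<le> k" for T
    using cells' that by simp
  define N where "N a = {b \<in> B. D a b}" for a
  define OK where "OK X = {b \<in> B. \<forall>a'\<in>X \<inter> A. D a' b}" for X
  define A1 where "A1 = {a \<in> A. \<delta> / 2 * card B \<le> card (N a)}"
  let ?I = "{..<s}"
  let ?F = "?I \<rightarrow>\<^sub>E B"
  have finF: "finite ?F" using fin by (simp add: finite_PiE)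
  have finN: "finite (N a)" "card (N a) \<le> card B" for a
    unfolding N_def using fin by (auto intro: card_mono)
  have A1: "finite A1" "A1 \<subseteq> A" unfolding A1_def using fin by auto
  have B0: "card B > 0" using fin ne by auto
  have A0: "card A > 0" using fin ne by auto
  have "\<delta> * card A * card B \<le> (\<Sum>a\<in>A. real (card (N a)))"
  proof -
    have "{(a, b). a \<in> A \<and> b \<in> B \<and> D a b} = (SIGMA a:A. N a)" unfolding N_def by auto
    then show ?thesis using dense fin finN by (simp add: card_SigmaI)
  qed
  also have "\<dots> = (\<Sum>a\<in>A1. real (card (N a))) + (\<Sum>a\<in>A - A1. real (card (N a)))"
    using sum.subset_diff[OF A1(2) fin(1)] by (simp add: add.commute)
  also have "\<dots> \<le> (\<Sum>a\<in>A1. real (card B)) + (\<Sum>a\<in>A - A1. \<delta> / 2 * card B)"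
    using finN unfolding A1_def by (intro add_mono sum_mono) auto
  also have "\<dots> \<le> card A1 * real (card B) + card A * (\<delta> / 2 * card B)"
    using \<open>\<delta> > 0\<close> fin by (auto intro!: add_mono mult_right_mono card_mono)
  finally have "(\<delta> / 2 * card A) * card B \<le> card A1 * real (card B)"
    by (simp add: field_simps)
  then have cardA1: "\<delta> / 2 * card A \<le> card A1" using B0 by simp
  let ?good = "\<lambda>a f. \<exists>X\<in>all_cells k cells (f ` ?I). a \<in> X \<and> \<delta> / 8 * card B \<le> card (OK X)"
  have "(\<delta> / 2) ^ s / 2 * card ?F \<le> card {f \<in> ?F. ?good a f}" if a: "a \<in> A1" for a
  proof -
    have aA: "a \<in> A" and large: "\<delta> / 2 * card B \<le> card (N a)" using a unfolding A1_def by auto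
    let ?G = "{f \<in> ?I \<rightarrow>\<^sub>E N a. \<exists>X\<in>all_cells k cells (f ` ?I). a \<in> X \<and>
                 card (N a) \<le> 4 * card (OK X \<inter> N a)}"
    have "card (N a) ^ card ?I \<le> 2 * card ?G"
    proof (rule half_of_samples_good[OF finN(1)])
      fix S assume S: "S \<subseteq> N a"
      then have SB: "S \<subseteq> B" "\<forall>b\<in>S. D a b" unfolding N_def by auto
      obtain T X where "T \<subseteq> S" "finite T" "card T \<le> k" "X \<in> cells T" "a \<in> X"
          "\<forall>a'\<in>X \<inter> A. \<forall>b\<in>S. D a' b"
        using ex[rule_format, OF aA SB(1)] SB(2) by auto
      moreover from this have "S \<subseteq> OK X \<inter> N a" unfolding OK_def using S SB by auto
      ultimately show "\<exists>T\<subseteq>S. finite T \<and> card T \<le> k \<and> (\<exists>X\<in>cells T. a \<in> X \<and> S \<subseteq> OK X \<inter> N a)"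
        by blast
    qed (use cells s in auto)
    moreover have "?G \<subseteq> {f \<in> ?F. ?good a f}"
    proof
      fix f assume f: "f \<in> ?G"
      then obtain X where X: "X \<in> all_cells k cells (f ` ?I)" "a \<in> X"
        "card (N a) \<le> 4 * card (OK X \<inter> N a)" by blast
      have "card (OK X \<inter> N a) \<le> card (OK X)"
        unfolding OK_def using fin by (intro card_mono) auto
      with X(3) have "card (N a) \<le> 4 * card (OK X)" by linarith
      then have "\<delta> / 8 * card B \<le> card (OK X)" using large by simp
      moreover have "f \<in> ?F" using f PiE_mono[of ?I "\<lambda>_. N a" "\<lambda>_. B"] unfolding N_def by auto
      ultimately show "f \<in> {f \<in> ?F. ?good a f}" using X by blast
    qed
    then have "card ?G \<le> card {f \<in> ?F. ?good a f}"
      by (rule card_mono[rotated]) (rule finite_subset[OF _ finF], blast)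
    ultimately have "card (N a) ^ s \<le> 2 * card {f \<in> ?F. ?good a f}" by simp
    from of_nat_mono[OF this, where 'a = real]
    have "real (card (N a)) ^ s \<le> 2 * real (card {f \<in> ?F. ?good a f})" by simp
    moreover have "(\<delta> / 2) ^ s * real (card B) ^ s \<le> real (card (N a)) ^ s"
      unfolding power_mult_distrib[symmetric] using large \<open>\<delta> > 0\<close> by (intro power_mono) auto
    moreover have "real (card ?F) = real (card B) ^ s" by (simp add: card_PiE)
    ultimately show ?thesis by simp
  qed
  moreover have "?F \<noteq> {}" using ne by (simp add: PiE_eq_empty_iff)
  ultimately obtain f where f: "f \<in> ?F" "(\<delta> / 2) ^ s / 2 * card A1 \<le> card {a \<in> A1. ?good a f}"
    using large_fibre[of A1 ?F "(\<delta> / 2) ^ s / 2" ?good] A1(1) finF by blast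
  let ?W = "all_cells k cells (f ` ?I)"
  have "finite (f ` ?I)" by simp
  note W = all_cells_bound[OF this, of k cells m, OF cells]
  let ?W' = "{X \<in> ?W. \<delta> / 8 * card B \<le> card (OK X)}"
  have "card ?W' \<le> card ?W" using W(1) by (intro card_mono) auto
  also have "\<dots> \<le> 2 ^ card (f ` ?I) * m" by (rule W(2))
  also have "\<dots> \<le> 2 ^ s * 2 ^ m"
    using card_image_le[of ?I f] by (intro mult_mono power_increasing) (auto simp: less_imp_le)
  finally have cardW: "card ?W' \<le> 2 ^ (s + m)" by (simp add: power_add)
  have lower: "(\<delta> / 2) ^ (s + 1) / 2 * card A \<le> card {a \<in> A1. ?good a f}"
  proof -
    have "(\<delta> / 2) ^ (s + 1) / 2 * card A = (\<delta> / 2) ^ s / 2 * (\<delta> / 2 * card A)" by simp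
    also have "\<dots> \<le> (\<delta> / 2) ^ s / 2 * card A1"
      using cardA1 \<open>\<delta> > 0\<close> by (intro mult_left_mono) auto
    also note f(2)
    finally show ?thesis .
  qed
  let ?q = "(\<delta> / 2) ^ (s + 1) / 2 ^ (s + m + 1) * card A"
  have "\<exists>X\<in>?W'. ?q \<le> card (X \<inter> A)"
  proof (rule ccontr)
    assume "\<not> ?thesis"
    then have small: "card (X \<inter> A) < ?q" if "X \<in> ?W'" for X using that by auto
    have "card {a \<in> A1. ?good a f} \<le> card (\<Union>X\<in>?W'. X \<inter> A)"
      using W(1) fin A1 by (intro card_mono) auto
    also have "\<dots> \<le> (\<Sum>X\<in>?W'. card (X \<inter> A))" using W(1) by (intro card_UN_le) auto
    finally have "card {a \<in> A1. ?good a f} \<le> (\<Sum>X\<in>?W'. card (X \<inter> A))" .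
    from of_nat_mono[OF this, where 'a = real]
    have le: "card {a \<in> A1. ?good a f} \<le> (\<Sum>X\<in>?W'. real (card (X \<inter> A)))" by simp
    have pos: "0 < (\<delta> / 2) ^ (s + 1) / 2 * card A" using \<open>\<delta> > 0\<close> A0 by simp
    have "?W' \<noteq> {}"
    proof
      assume "?W' = {}"
      then have "(\<Sum>X\<in>?W'. real (card (X \<inter> A))) = 0" by (simp only: sum.empty)
      with le lower pos show False by linarith
    qed
    then have "(\<Sum>X\<in>?W'. real (card (X \<inter> A))) < (\<Sum>X\<in>?W'. ?q)"
      using small W(1) by (intro sum_strict_mono) auto
    also have "\<dots> \<le> 2 ^ (s + m) * ?q"
    proof -
      have "real (card ?W') \<le> 2 ^ (s + m)"
        using of_nat_mono[OF cardW, where 'a = real] by simp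
      then have "real (card ?W') * ?q \<le> 2 ^ (s + m) * ?q"
        using \<open>\<delta> > 0\<close> by (intro mult_right_mono) auto
      then show ?thesis by simp
    qed
    also have "\<dots> = (\<delta> / 2) ^ (s + 1) / 2 * card A" by (simp add: power_add)
    finally show False using le lower by linarith
  qed
  then obtain X where "X \<in> ?W'" "?q \<le> card (X \<inter> A)" by blast
  then show thesis
    by (intro that[of "X \<inter> A" "OK X"]) (auto simp: OK_def)
qed

section \<open>Points and arcs\<close>

text \<open>
  The difference of two functions on their common interval changes its sign at most once, where a
  zero may be read as either sign. In particular the functions cannot touch at an
  inner point of the interval, but they may meet at an end of it.
\<close>

definition crosses_once ::
    "real \<Rightarrow> real \<Rightarrow> (real \<Rightarrow> real) \<Rightarrow> real \<Rightarrow> real \<Rightarrow> (real \<Rightarrow> real) \<Rightarrow> bool" where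
  "crosses_once l r f l' r' g \<longleftrightarrow>
     (\<forall>x y z. max l l' \<le> x \<and> x < y \<and> y < z \<and> z \<le> min r r' \<longrightarrow>
        \<not> (f x \<le> g x \<and> g y \<le> f y \<and> f z \<le> g z) \<and>
        \<not> (g x \<le> f x \<and> f y \<le> g y \<and> g z \<le> f z))"

definition pseudo_arcs ::
    "'a set \<Rightarrow> ('a \<Rightarrow> real) \<Rightarrow> ('a \<Rightarrow> real) \<Rightarrow> ('a \<Rightarrow> real \<Rightarrow> real) \<Rightarrow> bool" where
  "pseudo_arcs A lo hi ht \<longleftrightarrow>
     (\<forall>a\<in>A. \<forall>b\<in>A. a \<noteq> b \<longrightarrow> crosses_once (lo a) (hi a) (ht a) (lo b) (hi b) (ht b))"

lemma pseudo_arcs_no_return: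
  assumes "pseudo_arcs A lo hi ht" "c \<in> A" "d \<in> A" "c \<noteq> d"
    and "lo c \<le> x" "lo d \<le> x" "x < y" "y < z" "z \<le> hi c" "z \<le> hi d"
  shows "\<not> (ht c x \<le> ht d x \<and> ht d y \<le> ht c y \<and> ht c z \<le> ht d z)"
proof -
  have "crosses_once (lo c) (hi c) (ht c) (lo d) (hi d) (ht d)"
    using assms unfolding pseudo_arcs_def by blast
  then show ?thesis
    using assms(5-) unfolding crosses_once_def by auto
qed

lemma ex_minimizer:
  fixes key :: "'a \<Rightarrow> real"
  assumes "finite S" "S \<noteq> {}"
  obtains c where "c \<in> S" "\<forall>x\<in>S. key c \<le> key x"
  using arg_min_if_finite(1)[OF assms, of key] arg_min_least[OF assms, of _ key] by blast

lemma ex_maximizer: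
  fixes key :: "'a \<Rightarrow> real"
  assumes "finite S" "S \<noteq> {}"
  obtains c where "c \<in> S" "\<forall>x\<in>S. key x \<le> key c"
  by (rule ex_minimizer[OF assms, of "\<lambda>c. - key c"]) (auto intro: that)

text \<open>
  The set \<open>N q\<close> consists of the elements that \<open>p\<close> fails to protect from violating \<open>q\<close>. If each of these
  sets lies entirely on one side of \<open>a\<close> in the order given by \<open>key\<close>, then it is enough to know
  \<open>p\<close> and the two sets whose elements come closest to \<open>a\<close> from either side: an element on the near
  side of both is not in any \<open>N q\<close>.
\<close>

lemma key_blockers:
  fixes key :: "'a \<Rightarrow> real" and R :: "'a \<Rightarrow> 'b \<Rightarrow> bool"
  assumes fin: "finite A" and "p \<in> S"
    and N: "\<And>q. N q = {c \<in> A. R c p \<and> \<not> R c q}"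
    and sides: "\<And>q. q \<in> S \<Longrightarrow> (\<forall>c\<in>N q. key a < key c) \<or> (\<forall>c\<in>N q. key c < key a)"
  obtains q1 q2 where "q1 \<in> S" "q2 \<in> S"
    "\<forall>c\<in>N q1. key a < key c" "\<forall>c\<in>N q2. key c < key a"
    "\<And>a' q. \<lbrakk>a' \<in> A; R a' p; \<forall>c\<in>N q1. key a' < key c; \<forall>c\<in>N q2. key c < key a'; q \<in> S\<rbrakk>
       \<Longrightarrow> R a' q"
proof -
  have Np: "N p = {}" using N by auto
  let ?U = "{c \<in> A. key a < key c \<and> (\<exists>q\<in>S. c \<in> N q)}"
  let ?L = "{c \<in> A. key c < key a \<and> (\<exists>q\<in>S. c \<in> N q)}"
  have "\<exists>q1\<in>S. (\<forall>c\<in>N q1. key a < key c) \<and> (\<forall>c\<in>?U. \<exists>c'\<in>N q1. key c' \<le> key c)"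
  proof (cases "?U = {}")
    case True
    then show ?thesis using \<open>p \<in> S\<close> Np by blast
  next
    case False
    have "finite ?U" using fin by simp
    then obtain c where c: "c \<in> ?U" "\<forall>c'\<in>?U. key c \<le> key c'"
      by (rule ex_minimizer[OF _ False])
    then obtain q where q: "q \<in> S" "c \<in> N q" by blast
    moreover have "\<forall>c\<in>N q. key a < key c"
      using sides[OF q(1)] q(2) c(1) by (auto dest: less_asym)
    ultimately show ?thesis using c(2) by (intro bexI[of _ q]) auto
  qed
  then obtain q1 where q1: "q1 \<in> S" "\<forall>c\<in>N q1. key a < key c"
    "\<forall>c\<in>?U. \<exists>c'\<in>N q1. key c' \<le> key c" by blast
  have "\<exists>q2\<in>S. (\<forall>c\<in>N q2. key c < key a) \<and> (\<forall>c\<in>?L. \<exists>c'\<in>N q2. key c \<le> key c')"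
  proof (cases "?L = {}")
    case True
    then show ?thesis using \<open>p \<in> S\<close> Np by blast
  next
    case False
    have "finite ?L" using fin by simp
    then obtain c where c: "c \<in> ?L" "\<forall>c'\<in>?L. key c' \<le> key c"
      by (rule ex_maximizer[OF _ False])
    then obtain q where q: "q \<in> S" "c \<in> N q" by blast
    moreover have "\<forall>c\<in>N q. key c < key a"
      using sides[OF q(1)] q(2) c(1) by (auto dest: less_asym)
    ultimately show ?thesis using c(2) by (intro bexI[of _ q]) auto
  qed
  then obtain q2 where q2: "q2 \<in> S" "\<forall>c\<in>N q2. key c < key a"
    "\<forall>c\<in>?L. \<exists>c'\<in>N q2. key c \<le> key c'" by blast
  show thesis
  proof (rule that[OF q1(1) q2(1) q1(2) q2(2)])
    fix a' q
    assume a': "a' \<in> A" "R a' p" "\<forall>c\<in>N q1. key a' < key c" "\<forall>c\<in>N q2. key c < key a'"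
      and q: "q \<in> S"
    show "R a' q"
    proof (rule ccontr)
      assume "\<not> R a' q"
      then have a'N: "a' \<in> N q" using N a' by auto
      from sides[OF q] show False
      proof
        assume "\<forall>c\<in>N q. key a < key c"
        then have "a' \<in> ?U" using a'N a'(1) q by blast
        then obtain c' where "c' \<in> N q1" "key c' \<le> key a'" using q1(3) by blast
        then show False using a'(3) by (meson linorder_not_le)
      next
        assume "\<forall>c\<in>N q. key c < key a"
        then have "a' \<in> ?L" using a'N a'(1) q by blast
        then obtain c' where "c' \<in> N q2" "key a' \<le> key c'" using q2(3) by blast
        then show False using a'(4) by (meson linorder_not_le)
      qed
    qed
  qed
qed

text \<open>
  This is the cell of \<open>a\<close> in a dual arrangement: order the arcs by their height at the rightmost of the
  given points, and turn every point into the curve that separates the arcs below it from the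
  others. Two such curves cross at most once. So among the given points above \<open>a\<close> there is one, \<open>p\<close>, whose
  dual curve is lowest over \<open>a\<close>: an arc below \<open>p\<close> but not below \<open>q\<close> comes after \<open>a\<close> if \<open>q\<close> is to
  the right of \<open>p\<close>, and before \<open>a\<close> if \<open>q\<close> is to the left. Lacking an actual curve, the proof says that \<open>q\<close>
  beats \<open>p\<close> if some arc violates this, shows that this is a strict partial order, and takes
  an unbeaten \<open>p\<close>.
\<close>

lemma certifiable_points_above_arcs:
  assumes fin: "finite A" "finite B" and arcs: "pseudo_arcs A lo hi ht"
  shows "certifiable (Suc (5 ^ 5)) 5 A B
           (\<lambda>a b. lo a \<le> px b \<and> px b \<le> hi a \<and> ht a (px b) < py b)"
proof -
  define A' where "A' u v = {c \<in> A. lo c \<le> u \<and> v \<le> hi c}" for u v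
  define R where "R c b \<longleftrightarrow> ht c (px b) < py b" for c b
  define N where "N u v p q = {c \<in> A' u v. R c p \<and> \<not> R c q}" for u v p q
  define cell where "cell xs =
    (let u = px (xs ! 0); v = px (xs ! 1); p = xs ! 2; q1 = xs ! 3; q2 = xs ! 4 in
      {c \<in> A' u v. R c p \<and> (\<forall>d\<in>N u v p q1. ht c v < ht d v) \<and> (\<forall>d\<in>N u v p q2. ht d v < ht c v)})"
    for xs
  show ?thesis
  proof (rule certifiable_from_tuples[where cell = cell, OF fin(2)])
    fix a S
    assume a: "a \<in> A" and S: "S \<subseteq> B" "finite S" "S \<noteq> {}"
      and above: "\<forall>b\<in>S. lo a \<le> px b \<and> px b \<le> hi a \<and> ht a (px b) < py b"
    \<comment> \<open>Arcs that reach from the leftmost to the rightmost point are defined over all the points.\<close>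
    obtain bl where bl: "bl \<in> S" "\<forall>b\<in>S. px bl \<le> px b"
      by (rule ex_minimizer[OF S(2,3)])
    obtain br where br: "br \<in> S" "\<forall>b\<in>S. px b \<le> px br"
      by (rule ex_maximizer[OF S(2,3)])
    define u v where "u = px bl" and "v = px br"
    have uv: "u \<le> px b" "px b \<le> v" if "b \<in> S" for b using bl br that unfolding u_def v_def by auto
    have aA': "a \<in> A' u v" unfolding A'_def u_def v_def using a above bl(1) br(1) by auto
    define beats where "beats p q \<longleftrightarrow>
      (\<exists>c\<in>N u v p q. px p \<le> px q \<and> ht c v \<le> ht a v \<or> px q \<le> px p \<and> ht a v \<le> ht c v)" for p q
    \<comment> \<open>The last premise excludes equal arcs, for which all the weak inequalities hold.\<close>
    have cross: False
      if "c \<in> A' u v" "d \<in> A' u v" "u \<le> x" "x < y" "y < z" "z \<le> v"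
        "ht c x \<le> ht d x" "ht d y \<le> ht c y" "ht c z \<le> ht d z"
        "ht c x < ht d x \<or> ht d y < ht c y \<or> ht c z < ht d z" for c d x y z
    proof -
      have "c \<noteq> d" using that(10) by auto
      then show False
        using pseudo_arcs_no_return[OF arcs, of c d x y z] that unfolding A'_def by force
    qed
    \<comment> \<open>An arc \<open>c\<close> witnesses that \<open>q\<close> beats \<open>p\<close>, and \<open>d\<close> witnesses that \<open>r\<close> beats \<open>q\<close>. At \<open>q\<close> the arc \<open>d\<close>
      is strictly below \<open>c\<close>. One of the two also witnesses that \<open>r\<close> beats \<open>p\<close>. If both
      moves go in the same direction and \<open>d\<close> is not below \<open>p\<close>, then \<open>c\<close> and \<open>d\<close> change sides between \<open>p\<close>
      and \<open>q\<close>, hence not again between \<open>q\<close> and \<open>r\<close>. If the directions differ, comparing both arcs with \<open>a\<close>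
      at the abscissa \<open>v\<close> takes the place of the sign at \<open>p\<close>.\<close>
    have trans: "beats p r" if p: "p \<in> S" and q: "q \<in> S" and r: "r \<in> S"
      and "beats p q" "beats q r" for p q r
    proof -
      obtain c where c: "c \<in> A' u v" "ht c (px p) < py p" "py q \<le> ht c (px q)"
        and cs: "px p \<le> px q \<and> ht c v \<le> ht a v \<or> px q \<le> px p \<and> ht a v \<le> ht c v"
        using \<open>beats p q\<close> unfolding beats_def N_def R_def by (auto simp: not_less)
      obtain d where d: "d \<in> A' u v" "ht d (px q) < py q" "py r \<le> ht d (px r)"
        and ds: "px q \<le> px r \<and> ht d v \<le> ht a v \<or> px r \<le> px q \<and> ht a v \<le> ht d v"
        using \<open>beats q r\<close> unfolding beats_def N_def R_def by (auto simp: not_less)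
      have dc: "ht d (px q) < ht c (px q)" using c d by linarith
      have byc: "beats p r" if "px p \<le> px r \<and> ht c v \<le> ht a v \<or> px r \<le> px p \<and> ht a v \<le> ht c v"
        "ht d (px r) \<le> ht c (px r)"
        unfolding beats_def N_def R_def using that c d by (auto simp: not_less intro!: bexI[of _ c])
      have byd: "beats p r" if "px p \<le> px r \<and> ht d v \<le> ht a v \<or> px r \<le> px p \<and> ht a v \<le> ht d v"
        "ht d (px p) < py p"
        unfolding beats_def N_def R_def using that c d by (auto simp: not_less intro!: bexI[of _ d])
      note P = uv[OF p] and Q = uv[OF q] and Rr = uv[OF r]
      consider (rr) "px p \<le> px q" "ht c v \<le> ht a v" "px q \<le> px r" "ht d v \<le> ht a v"
        | (rl) "px p \<le> px q" "ht c v \<le> ht a v" "px r \<le> px q" "ht a v \<le> ht d v"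
        | (lr) "px q \<le> px p" "ht a v \<le> ht c v" "px q \<le> px r" "ht d v \<le> ht a v"
        | (ll) "px q \<le> px p" "ht a v \<le> ht c v" "px r \<le> px q" "ht a v \<le> ht d v"
        using cs ds by blast
      then show "beats p r"
      proof cases
        case rr
        show ?thesis
        proof (cases "ht d (px p) < py p")
          case True
          then show ?thesis using rr byd by auto
        next
          case False
          then have "ht c (px p) < ht d (px p)" using c by linarith
          then have "px p < px q" using rr dc by (metis less_asym order_le_less)
          have "ht d (px r) \<le> ht c (px r)"
          proof (rule ccontr)
            assume "\<not> ?thesis"
            moreover from this dc rr have "px q < px r" by (metis less_imp_le order_le_less)
            ultimately show False
              using cross[OF c(1) d(1), of "px p" "px q" "px r"] dc P Rr
                \<open>px p < px q\<close> \<open>ht c (px p) < ht d (px p)\<close> by auto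
          qed
          then show ?thesis using byc rr by auto
        qed
      next
        case rl
        have "ht c v \<le> ht d v" using rl by linarith
        then have "px q < v" using dc Q by (metis linorder_not_le order_le_less)
        have le: "ht d x \<le> ht c x" if "u \<le> x" "x \<le> px q" for x
        proof (rule ccontr)
          assume "\<not> ?thesis"
          moreover from this dc that have "x < px q" by (metis less_imp_le order_le_less)
          ultimately show False
            using cross[OF c(1) d(1), of x "px q" v] dc \<open>px q < v\<close> \<open>ht c v \<le> ht d v\<close> that by auto
        qed
        show ?thesis
        proof (cases "px p \<le> px r")
          case True
          then show ?thesis using byc rl le[OF Rr(1)] by auto
        next
          case False
          then show ?thesis using byd rl le[OF P(1)] c by auto
        qed
      next
        case lr
        have "ht d v \<le> ht c v" using lr by linarith
        have le: "ht d x \<le> ht c x" if "px q \<le> x" "x \<le> v" for x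
        proof (rule ccontr)
          assume "\<not> ?thesis"
          moreover from this dc that have "px q < x" by (metis less_imp_le order_le_less)
          moreover from calculation \<open>ht d v \<le> ht c v\<close> that have "x < v"
            by (metis order_le_less)
          ultimately show False
            using cross[OF d(1) c(1), of "px q" x v] dc \<open>ht d v \<le> ht c v\<close> Q by auto
        qed
        show ?thesis
        proof (cases "px p \<le> px r")
          case True
          then show ?thesis using byd lr le[OF _ P(2)] c by auto
        next
          case False
          then show ?thesis using byc lr le[OF _ Rr(2)] by auto
        qed
      next
        case ll
        show ?thesis
        proof (cases "ht d (px p) < py p")
          case True
          then show ?thesis using ll byd by auto
        next
          case False
          then have *: "ht c (px p) < ht d (px p)" using c by linarith
          then have "px q < px p" using ll dc by (metis less_asym order_le_less)
          have "ht d (px r) \<le> ht c (px r)"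
          proof (rule ccontr)
            assume "\<not> ?thesis"
            moreover from this dc ll have "px r < px q" by (metis less_imp_le order_le_less)
            ultimately show False
              using cross[OF c(1) d(1), of "px r" "px q" "px p"] dc P Rr \<open>px q < px p\<close> * by auto
          qed
          then show ?thesis using byc ll by auto
        qed
      qed
    qed
    have irrefl: "\<not> beats p p" for p unfolding beats_def N_def by auto
    have "asymp_on S beats" using trans irrefl unfolding asymp_on_def by blast
    moreover have "transp_on S beats" using trans unfolding transp_on_def by blast
    ultimately obtain p where p: "p \<in> S" "\<forall>q\<in>S. \<not> beats p q"
      using Finite_Set.bex_max_element[OF S(2) _ _ S(3), of beats] irrefl by metis
    have sides: "(\<forall>c\<in>N u v p q. ht a v < ht c v) \<or> (\<forall>c\<in>N u v p q. ht c v < ht a v)"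
      if "q \<in> S" for q
      using p(2) that unfolding beats_def by (meson linorder_not_le linorder_linear)
    have finA': "finite (A' u v)" unfolding A'_def using fin by simp
    have Neq: "N u v p q = {c \<in> A' u v. R c p \<and> \<not> R c q}" for q
      unfolding N_def by (rule refl)
    obtain q1 q2 where q: "q1 \<in> S" "q2 \<in> S"
      "\<forall>c\<in>N u v p q1. ht a v < ht c v" "\<forall>c\<in>N u v p q2. ht c v < ht a v"
      and imp: "\<And>a' q. \<lbrakk>a' \<in> A' u v; R a' p; \<forall>c\<in>N u v p q1. ht a' v < ht c v;
         \<forall>c\<in>N u v p q2. ht c v < ht a' v; q \<in> S\<rbrakk> \<Longrightarrow> R a' q"
      by (rule key_blockers[where key = "\<lambda>c. ht c v" and R = R and N = "N u v p",
            OF finA' p(1) Neq sides])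
        (assumption, rule that)
    let ?xs = "[bl, br, p, q1, q2]"
    have cell: "cell ?xs = {c \<in> A' u v. R c p \<and> (\<forall>d\<in>N u v p q1. ht c v < ht d v) \<and>
                  (\<forall>d\<in>N u v p q2. ht d v < ht c v)}"
      unfolding cell_def Let_def u_def v_def by (simp add: numeral_eq_Suc)
    have "R a p" using above p(1) unfolding R_def by auto
    then have "a \<in> cell ?xs" unfolding cell using aA' q by auto
    moreover have "\<forall>a'\<in>cell ?xs \<inter> A. \<forall>b\<in>S. lo a' \<le> px b \<and> px b \<le> hi a' \<and> ht a' (px b) < py b"
    proof (intro ballI)
      fix a' b assume a': "a' \<in> cell ?xs \<inter> A" and b: "b \<in> S"
      then have "R a' b" using imp[of a' b] unfolding cell by blast
      then show "lo a' \<le> px b \<and> px b \<le> hi a' \<and> ht a' (px b) < py b"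
        using a' uv[OF b] unfolding cell A'_def R_def by auto
    qed
    ultimately show "\<exists>xs. set xs \<subseteq> S \<and> length xs = 5 \<and> a \<in> cell xs \<and>
        (\<forall>a'\<in>cell xs \<inter> A. \<forall>b\<in>S. lo a' \<le> px b \<and> px b \<le> hi a' \<and> ht a' (px b) < py b)"
      using bl(1) br(1) p(1) q(1,2) by (intro exI[of _ ?xs]) auto
  qed
qed

text \<open>
  The cell is a trapezoid of the vertical decomposition: \<open>p\<close> is the lowest of the given arcs over the
  point of \<open>a\<close>. Any other arc \<open>q\<close> can pass below \<open>p\<close> on one side of that point only, because
  it crosses \<open>p\<close> only once; this also covers an arc that meets \<open>p\<close> exactly over the point. The side
  walls of the trapezoid are put at the nearest points of the family between \<open>q\<close> and \<open>p\<close>, not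
  at the crossing.
\<close>

lemma certifiable_arcs_above_points:
  assumes fin: "finite A" "finite B" and arcs: "pseudo_arcs B lo hi ht"
  shows "certifiable (Suc (5 ^ 5)) 5 A B
           (\<lambda>a b. lo b \<le> px a \<and> px a \<le> hi b \<and> py a < ht b (px a))"
proof -
  define A' where "A' u v = {c \<in> A. u \<le> px c \<and> px c \<le> v}" for u v
  define R where "R c b \<longleftrightarrow> py c < ht b (px c)" for c b
  define N where "N u v p q = {c \<in> A' u v. R c p \<and> \<not> R c q}" for u v p q
  define cell where "cell xs =
    (let u = lo (xs ! 0); v = hi (xs ! 1); p = xs ! 2; q1 = xs ! 3; q2 = xs ! 4 in
      {c \<in> A' u v. R c p \<and> (\<forall>d\<in>N u v p q1. px c < px d) \<and> (\<forall>d\<in>N u v p q2. px d < px c)})"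
    for xs
  show ?thesis
  proof (rule certifiable_from_tuples[where cell = cell, OF fin(2)])
    fix a S
    assume a: "a \<in> A" and S: "S \<subseteq> B" "finite S" "S \<noteq> {}"
      and above: "\<forall>b\<in>S. lo b \<le> px a \<and> px a \<le> hi b \<and> py a < ht b (px a)"
    obtain bl where bl: "bl \<in> S" "\<forall>b\<in>S. lo b \<le> lo bl" by (rule ex_maximizer[OF S(2,3)])
    obtain br where br: "br \<in> S" "\<forall>b\<in>S. hi br \<le> hi b" by (rule ex_minimizer[OF S(2,3)])
    define u v where "u = lo bl" and "v = hi br"
    have uv: "lo b \<le> u" "v \<le> hi b" if "b \<in> S" for b using bl br that unfolding u_def v_def by auto
    have aA': "a \<in> A' u v" unfolding A'_def u_def v_def using a above bl(1) br(1) by auto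
    obtain p where p: "p \<in> S" "\<forall>b\<in>S. ht p (px a) \<le> ht b (px a)"
      by (rule ex_minimizer[OF S(2,3), of "\<lambda>b. ht b (px a)"])
    have finA': "finite (A' u v)" unfolding A'_def using fin by simp
    have Neq: "N u v p q = {c \<in> A' u v. R c p \<and> \<not> R c q}" for q
      unfolding N_def by (rule refl)
    have sides: "(\<forall>c\<in>N u v p q. px a < px c) \<or> (\<forall>c\<in>N u v p q. px c < px a)"
      if q: "q \<in> S" for q
    proof (rule ccontr)
      assume "\<not> ?thesis"
      then obtain c d where c: "c \<in> N u v p q" "px c \<le> px a" and d: "d \<in> N u v p q" "px a \<le> px d"
        by (auto simp: not_less)
      have low: "ht q (px c) < ht p (px c)" "ht q (px d) < ht p (px d)"
        using c(1) d(1) unfolding N_def R_def by auto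
      have ge: "ht p (px a) \<le> ht q (px a)" using p(2) q by blast
      have "px c \<noteq> px a" "px d \<noteq> px a" using low ge by auto
      then have "px c < px a" "px a < px d" using c(2) d(2) by auto
      moreover have "u \<le> px c" "px d \<le> v" using c(1) d(1) unfolding N_def A'_def by auto
      moreover have "q \<in> B" "p \<in> B" "q \<noteq> p" using q p(1) S(1) low by auto
      ultimately show False
        using pseudo_arcs_no_return[OF arcs, of q p "px c" "px a" "px d"] low ge uv[OF q] uv[OF p(1)]
        by auto
    qed
    obtain q1 q2 where q: "q1 \<in> S" "q2 \<in> S"
      "\<forall>c\<in>N u v p q1. px a < px c" "\<forall>c\<in>N u v p q2. px c < px a"
      and imp: "\<And>a' q. \<lbrakk>a' \<in> A' u v; R a' p; \<forall>c\<in>N u v p q1. px a' < px c;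
         \<forall>c\<in>N u v p q2. px c < px a'; q \<in> S\<rbrakk> \<Longrightarrow> R a' q"
      by (rule key_blockers[where key = px and R = R and N = "N u v p", OF finA' p(1) Neq sides])
        (assumption, rule that)
    let ?xs = "[bl, br, p, q1, q2]"
    have cell: "cell ?xs = {c \<in> A' u v. R c p \<and> (\<forall>d\<in>N u v p q1. px c < px d) \<and>
                  (\<forall>d\<in>N u v p q2. px d < px c)}"
      unfolding cell_def Let_def u_def v_def by (simp add: numeral_eq_Suc)
    have "R a p" using above p(1) unfolding R_def by auto
    then have "a \<in> cell ?xs" unfolding cell using aA' q by auto
    moreover have "\<forall>a'\<in>cell ?xs \<inter> A. \<forall>b\<in>S. lo b \<le> px a' \<and> px a' \<le> hi b \<and> py a' < ht b (px a')"
    proof (intro ballI)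
      fix a' b assume a': "a' \<in> cell ?xs \<inter> A" and b: "b \<in> S"
      then have "R a' b" using imp[of a' b] unfolding cell by blast
      then show "lo b \<le> px a' \<and> px a' \<le> hi b \<and> py a' < ht b (px a')"
        using a' uv[OF b] unfolding cell A'_def R_def by auto
    qed
    ultimately show "\<exists>xs. set xs \<subseteq> S \<and> length xs = 5 \<and> a \<in> cell xs \<and>
        (\<forall>a'\<in>cell xs \<inter> A. \<forall>b\<in>S. lo b \<le> px a' \<and> px a' \<le> hi b \<and> py a' < ht b (px a'))"
      using bl(1) br(1) p(1) q(1,2) by (intro exI[of _ ?xs]) auto
  qed
qed

lemma certifiable_less:
  fixes f :: "'a \<Rightarrow> real" and g :: "'b \<Rightarrow> real"
  assumes "finite B"
  shows "certifiable (Suc (1 ^ 1)) 1 A B (\<lambda>a b. g b < f a)"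
proof (rule certifiable_from_tuples[where cell = "\<lambda>xs. {a. g (hd xs) < f a}", OF assms])
  fix a S assume "a \<in> A" and S: "S \<subseteq> B" "finite S" "S \<noteq> {}" "\<forall>b\<in>S. g b < f a"
  obtain b where "b \<in> S" "\<forall>b'\<in>S. g b' \<le> g b" by (rule ex_maximizer[OF S(2,3)])
  then show "\<exists>xs. set xs \<subseteq> S \<and> length xs = 1 \<and> a \<in> {a. g (hd xs) < f a} \<and>
      (\<forall>a'\<in>{a. g (hd xs) < f a} \<inter> A. \<forall>b\<in>S. g b < f a')"
    using S(4) by (intro exI[of _ "[b]"]) force
qed

lemma pseudo_arcs_uminus:
  assumes "pseudo_arcs A lo hi ht"
  shows "pseudo_arcs A lo hi (\<lambda>a x. - ht a x)"
  using assms unfolding pseudo_arcs_def crosses_once_def by fastforce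

text \<open>
  The first arc lies strictly below the second one at both ends of their common interval. The left
  end is the left endpoint of whichever arc starts later, and similarly on the right, so each end
  gives one disjunct of either kind: a point of the first arc below the second arc, or a point of the
  second arc above the first. Negating all heights gives the case where the first arc is above.
\<close>

definition overlap_below where
  "overlap_below lo1 hi1 ht1 lo2 hi2 ht2 a b \<longleftrightarrow>
     ((lo2 b \<le> lo1 a \<and> lo1 a \<le> hi2 b \<and> ht1 a (lo1 a) < ht2 b (lo1 a)) \<or>
      (lo1 a \<le> lo2 b \<and> lo2 b \<le> hi1 a \<and> ht1 a (lo2 b) < ht2 b (lo2 b))) \<and>
     ((lo2 b \<le> hi1 a \<and> hi1 a \<le> hi2 b \<and> ht1 a (hi1 a) < ht2 b (hi1 a)) \<or>
      (lo1 a \<le> hi2 b \<and> hi2 b \<le> hi1 a \<and> ht1 a (hi2 b) < ht2 b (hi2 b)))"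
  for a :: 'a and b :: 'b and lo1 hi1 lo2 hi2 :: "_ \<Rightarrow> real" and ht1 ht2 :: "_ \<Rightarrow> real \<Rightarrow> real"

definition arcs_apart where
  "arcs_apart lo1 hi1 ht1 lo2 hi2 ht2 a b \<longleftrightarrow>
     hi2 b < lo1 a \<or> hi1 a < lo2 b \<or>
     overlap_below lo1 hi1 ht1 lo2 hi2 ht2 a b \<or>
     overlap_below lo1 hi1 (\<lambda>a x. - ht1 a x) lo2 hi2 (\<lambda>b x. - ht2 b x) a b"
  for a :: 'a and b :: 'b and lo1 hi1 lo2 hi2 :: "_ \<Rightarrow> real" and ht1 ht2 :: "_ \<Rightarrow> real \<Rightarrow> real"

lemma certifiable_overlap_below:
  "\<exists>m k. \<forall>(A :: 'a set) (B :: 'b set) lo1 hi1 ht1 lo2 hi2 ht2.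
     finite A \<longrightarrow> finite B \<longrightarrow> pseudo_arcs A lo1 hi1 ht1 \<longrightarrow> pseudo_arcs B lo2 hi2 ht2 \<longrightarrow>
     certifiable m k A B (overlap_below lo1 hi1 ht1 lo2 hi2 ht2)"
  unfolding overlap_below_def[abs_def]
  by (rule exI, rule exI, intro allI impI, rule certifiable_conj; rule certifiable_disj;
      rule certifiable_points_above_arcs certifiable_arcs_above_points; assumption)

lemma certifiable_arcs_apart:
  "\<exists>m k. \<forall>(A :: 'a set) (B :: 'b set) lo1 hi1 ht1 lo2 hi2 ht2.
     finite A \<longrightarrow> finite B \<longrightarrow> pseudo_arcs A lo1 hi1 ht1 \<longrightarrow> pseudo_arcs B lo2 hi2 ht2 \<longrightarrow>
     certifiable m k A B (arcs_apart lo1 hi1 ht1 lo2 hi2 ht2)"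
proof -
  obtain m k where ob: "\<forall>(A :: 'a set) (B :: 'b set) lo1 hi1 ht1 lo2 hi2 ht2.
     finite A \<longrightarrow> finite B \<longrightarrow> pseudo_arcs A lo1 hi1 ht1 \<longrightarrow> pseudo_arcs B lo2 hi2 ht2 \<longrightarrow>
     certifiable m k A B (overlap_below lo1 hi1 ht1 lo2 hi2 ht2)"
    using certifiable_overlap_below by (elim exE)
  have "certifiable (4 ^ (1 + (1 + (k + k))) * Suc (1 ^ 1) *
      (4 ^ (1 + (k + k)) * Suc (1 ^ 1) * (4 ^ (k + k) * m * m))) (1 + (1 + (k + k))) A B
      (arcs_apart lo1 hi1 ht1 lo2 hi2 ht2)"
    if fin: "finite A" "finite B"
      and arcs: "pseudo_arcs A lo1 hi1 ht1" "pseudo_arcs B lo2 hi2 ht2"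
    for A :: "'a set" and B :: "'b set" and lo1 hi1 ht1 lo2 hi2 ht2
  proof -
    have right: "certifiable (Suc (1 ^ 1)) 1 A B (\<lambda>a b. hi1 a < lo2 b)"
      using certifiable_less[OF fin(2), of A "\<lambda>b. - lo2 b" "\<lambda>a. - hi1 a"] by simp
    note arcs' = pseudo_arcs_uminus[OF arcs(1)] pseudo_arcs_uminus[OF arcs(2)]
    show ?thesis
      unfolding arcs_apart_def[abs_def]
      by (rule certifiable_disj[OF certifiable_less[OF fin(2)] certifiable_disj[OF right
            certifiable_disj[OF ob[rule_format, OF fin arcs] ob[rule_format, OF fin arcs']]]])
  qed
  then show ?thesis by (intro exI allI impI)
qed

text \<open>
  An arc that is strictly below the other at both ends of the common interval and meets it in between
  would have to change sides twice.
\<close>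

lemma arcs_apart_imp_disjoint:
  assumes once: "crosses_once (lo1 a) (hi1 a) (ht1 a) (lo2 b) (hi2 b) (ht2 b)"
    and apart: "arcs_apart lo1 hi1 ht1 lo2 hi2 ht2 a b"
    and x: "lo1 a \<le> x" "x \<le> hi1 a" "lo2 b \<le> x" "x \<le> hi2 b"
  shows "ht1 a x \<noteq> ht2 b x"
proof
  assume eq: "ht1 a x = ht2 b x"
  have ov: False
    if ob: "overlap_below lo1 hi1 f lo2 hi2 g a b"
      and once: "crosses_once (lo1 a) (hi1 a) (f a) (lo2 b) (hi2 b) (g b)" and eq: "f a x = g b x"
    for f g
  proof -
    let ?l = "max (lo1 a) (lo2 b)" and ?r = "min (hi1 a) (hi2 b)"
    have l: "f a ?l < g b ?l" and r: "f a ?r < g b ?r"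
      using ob unfolding overlap_below_def by (auto simp: max_def min_def)
    have "?l \<le> x" "x \<le> ?r" using x by auto
    then have "?l < x" "x < ?r" using l r eq by (metis less_irrefl order_le_less)+
    then show False using once l r eq unfolding crosses_once_def by (metis order_refl order_less_imp_le)
  qed
  have once': "crosses_once (lo1 a) (hi1 a) (\<lambda>x. - ht1 a x) (lo2 b) (hi2 b) (\<lambda>x. - ht2 b x)"
    using once unfolding crosses_once_def by force
  from apart show False
    unfolding arcs_apart_def
    using x ov[of ht1 ht2, OF _ once eq] ov[of "\<lambda>a x. - ht1 a x" "\<lambda>b x. - ht2 b x", OF _ once'] eq by auto
qed

text \<open>
  By the intermediate value theorem.
\<close>

lemma disjoint_imp_arcs_apart:
  assumes ord: "lo1 a \<le> hi1 a" "lo2 b \<le> hi2 b"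
    and cont: "continuous_on {lo1 a..hi1 a} (ht1 a)" "continuous_on {lo2 b..hi2 b} (ht2 b)"
    and disj: "\<And>x. \<lbrakk>lo1 a \<le> x; x \<le> hi1 a; lo2 b \<le> x; x \<le> hi2 b\<rbrakk> \<Longrightarrow> ht1 a x \<noteq> ht2 b x"
  shows "arcs_apart lo1 hi1 ht1 lo2 hi2 ht2 a b"
proof (cases "hi2 b < lo1 a \<or> hi1 a < lo2 b")
  case True
  then show ?thesis unfolding arcs_apart_def by blast
next
  case False
  let ?l = "max (lo1 a) (lo2 b)" and ?r = "min (hi1 a) (hi2 b)"
  have lr: "?l \<le> ?r" using False ord by auto
  have c: "continuous_on {?l..?r} (\<lambda>x. ht2 b x - ht1 a x)"
    by (intro continuous_on_diff continuous_on_subset[OF cont(1)] continuous_on_subset[OF cont(2)]) auto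
  have nz: "ht2 b x - ht1 a x \<noteq> 0" if "?l \<le> x" "x \<le> ?r" for x
    using disj[of x] that by auto
  have "(0 < ht2 b ?l - ht1 a ?l \<and> 0 < ht2 b ?r - ht1 a ?r) \<or>
        (ht2 b ?l - ht1 a ?l < 0 \<and> ht2 b ?r - ht1 a ?r < 0)"
  proof (rule ccontr)
    assume "\<not> ?thesis"
    then have "(ht2 b ?l - ht1 a ?l < 0 \<and> 0 < ht2 b ?r - ht1 a ?r) \<or>
               (ht2 b ?r - ht1 a ?r < 0 \<and> 0 < ht2 b ?l - ht1 a ?l)"
      using nz[of ?l] nz[of ?r] lr by (meson linorder_neqE_linordered_idom order_refl)
    then have "\<exists>x. ?l \<le> x \<and> x \<le> ?r \<and> ht2 b x - ht1 a x = 0"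
      using IVT'[OF _ _ lr c, of 0] IVT2'[OF _ _ lr c, of 0] by (auto simp del: max.bounded_iff min.bounded_iff)
    with nz show False by blast
  qed
  then show ?thesis
    unfolding arcs_apart_def overlap_below_def using False ord
    by (cases "lo1 a \<le> lo2 b"; cases "hi1 a \<le> hi2 b") auto
qed

section \<open>Cutting a curve at its vertical tangents\<close>

definition graph_over :: "(real \<Rightarrow> real) \<Rightarrow> real \<Rightarrow> real \<Rightarrow> (real \<times> real) set" where
  "graph_over h l r = (\<lambda>x. (x, h x)) ` {l..r}"

text \<open>
  The neighbourhood \<open>W\<close> records that no other part of the curve comes near an inner point of the
  piece, so that a proper crossing of curves is a crossing of these pieces.
\<close>

definition monotone_piece ::
    "(real \<times> real) set \<Rightarrow> real \<Rightarrow> real \<Rightarrow> (real \<Rightarrow> real) \<Rightarrow> bool" where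
  "monotone_piece C l r h \<longleftrightarrow> l < r \<and> continuous_on {l..r} h \<and> graph_over h l r \<subseteq> C \<and>
     (\<forall>x\<in>{l<..<r}. (x, h x) \<in> curve_interior C \<and>
        (\<exists>W. open W \<and> (x, h x) \<in> W \<and> C \<inter> W \<subseteq> graph_over h l r))"

lemma mem_graph_over: "(x, v) \<in> graph_over h l r \<longleftrightarrow> l \<le> x \<and> x \<le> r \<and> v = h x"
  unfolding graph_over_def by auto

lemma regular_param_continuous: "regular_param f a b \<Longrightarrow> continuous_on {a..b} f"
  unfolding regular_param_def
  by (meson continuous_on_eq_continuous_within has_vector_derivative_continuous)

lemma param_ofD:
  assumes "param_of f a b C"
  shows "a < b" "inj_on f {a..b}" "continuous_on {a..b} f" "f ` {a..b} = C"
  using assms regular_param_continuous[of f a b] unfolding param_of_def regular_param_def by blast+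

text \<open>
  The change of parameter between two parametrizations is a continuous injection of intervals, hence
  strictly monotone, and it maps inner parameters to inner parameters. So the interior of a curve can be
  computed from any parametrization.
\<close>

lemma inner_param_not_endpoint:
  assumes f: "param_of f a b C" and g: "param_of g c d C" and s: "a < s" "s < b"
  shows "f s \<noteq> g c" and "f s \<noteq> g d"
proof -
  have f': "continuous_on {a..b} f" "inj_on f {a..b}" "f ` {a..b} = C"
    and g': "continuous_on {c..d} g" "inj_on g {c..d}" "g ` {c..d} = C" "c < d"
    using param_ofD[OF f] param_ofD[OF g] by blast+
  define \<phi> where "\<phi> = the_inv_into {c..d} g \<circ> f"
  have inv: "\<And>x. x \<in> {c..d} \<Longrightarrow> the_inv_into {c..d} g (g x) = x"
    using g'(2) by (simp add: the_inv_into_f_f)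
  have "continuous_on C (the_inv_into {c..d} g)"
    using continuous_on_inv[OF g'(1) compact_Icc, of "the_inv_into {c..d} g"] inv g'(3) by simp
  then have cont: "continuous_on {a..b} \<phi>"
    unfolding \<phi>_def using f'(1,3) by (intro continuous_on_compose) simp_all
  have inj_inv: "inj_on (the_inv_into {c..d} g) C"
    using inj_on_the_inv_into[OF g'(2)] g'(3) by simp
  then have inj: "inj_on \<phi> {a..b}"
    unfolding \<phi>_def using f'(2,3) by (simp add: comp_inj_on)
  have range: "\<phi> x \<in> {c..d}" if "x \<in> {a..b}" for x
  proof -
    have "f x \<in> g ` {c..d}" using that f'(3) g'(3) by blast
    then show ?thesis unfolding \<phi>_def using inv by auto
  qed
  have btw: "(\<phi> a < \<phi> s \<and> \<phi> s < \<phi> b) \<or> (\<phi> b < \<phi> s \<and> \<phi> s < \<phi> a)"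
    using continuous_inj_imp_mono[OF s cont inj] by blast
  have "\<phi> a \<in> {c..d}" "\<phi> b \<in> {c..d}" using range s by auto
  then have "\<phi> s \<noteq> c" "\<phi> s \<noteq> d" using btw by auto
  then show "f s \<noteq> g c" "f s \<noteq> g d"
    unfolding \<phi>_def using inv[of c] inv[of d] g'(4) by auto
qed

lemma inner_param_in_curve_interior:
  assumes "param_of f a b C" "a < s" "s < b"
  shows "f s \<in> curve_interior C"
proof -
  have "f s \<in> C" using assms unfolding param_of_def by auto
  then show ?thesis
    unfolding curve_interior_def curve_endpoints_def
    using inner_param_not_endpoint[OF assms(1) _ assms(2,3)] by blast
qed

text \<open>
  By Rolle's theorem the first coordinate is injective on a stretch whose inner points have no vertical
  tangent, so it can serve as the parameter there.
\<close>

lemma monotone_piece_of_param: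
  assumes f: "param_of f a b C"
    and f': "\<forall>s\<in>{a..b}. (f has_vector_derivative f' s) (at s within {a..b})"
    and uv: "a \<le> u" "u < v" "v \<le> b"
    and nonvert: "\<forall>s\<in>{u<..<v}. fst (f' s) \<noteq> 0"
  shows "\<exists>l r h. monotone_piece C l r h \<and> graph_over h l r = f ` {u..v}"
proof -
  have reg: "inj_on f {a..b}" "f ` {a..b} = C" "continuous_on {a..b} f"
    by (rule param_ofD[OF f])+
  define X where "X = fst \<circ> f"
  have sub: "{u..v} \<subseteq> {a..b}" using uv by auto
  have contf: "continuous_on {u..v} f" using reg(3) sub by (rule continuous_on_subset)
  have contX: "continuous_on {u..v} X"
    unfolding X_def o_def using contf by (rule continuous_on_fst)
  have derX: "(X has_real_derivative fst (f' s)) (at s)" if s: "u < s" "s < v" for s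
  proof -
    have "(f has_vector_derivative f' s) (at s within {a..b})" using s uv by (intro bspec[OF f']) auto
    moreover have "at s within {a..b} = at s"
      using s uv by (intro at_within_Icc_at) auto
    ultimately have "(f has_vector_derivative f' s) (at s)" by metis
    then have "(X has_vector_derivative fst (f' s)) (at s)"
      unfolding X_def o_def by (rule bounded_linear.has_vector_derivative[OF bounded_linear_fst])
    then show ?thesis by (rule has_real_derivative_iff_has_vector_derivative[THEN iffD2])
  qed
  have injX: "inj_on X {u..v}"
  proof (rule linorder_inj_onI)
    fix s t assume st: "s < t" "s \<in> {u..v}" "t \<in> {u..v}"
    show "X s \<noteq> X t"
    proof
      assume eq: "X s = X t"
      have "\<exists>z. s < z \<and> z < t \<and> DERIV X z :> 0"
      proof (rule Rolle[OF st(1) eq])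
        show "continuous_on {s..t} X" using contX by (rule continuous_on_subset) (use st in auto)
        fix z assume "s < z" "z < t"
        then show "X differentiable (at z)" using derX[of z] st real_differentiable_def by auto
      qed
      then obtain z where z: "s < z" "z < t" "DERIV X z :> 0" by blast
      then have "fst (f' z) = 0" using DERIV_unique[OF derX[of z]] st by auto
      with nonvert z st show False by auto
    qed
  qed auto
  define l where "l = min (X u) (X v)"
  define r where "r = max (X u) (X v)"
  have "X u \<noteq> X v" using injX uv by (auto dest: inj_onD)
  then have lr: "l < r" unfolding l_def r_def by auto
  have btw: "l < X s \<and> X s < r" if "u < s" "s < v" for s
    using continuous_inj_imp_mono[OF that contX injX] unfolding l_def r_def by auto
  have ends: "s = u \<or> s = v \<or> (u < s \<and> s < v)" if "s \<in> {u..v}" for s using that by auto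
  have imX: "X ` {u..v} = {l..r}"
  proof
    show "X ` {u..v} \<subseteq> {l..r}"
    proof
      fix x assume "x \<in> X ` {u..v}"
      then obtain s where "s \<in> {u..v}" "x = X s" by blast
      then show "x \<in> {l..r}" using ends[of s] btw[of s] unfolding l_def r_def by auto
    qed
    have "connected (X ` {u..v})" using contX by (intro connected_continuous_image) auto
    moreover have "l \<in> X ` {u..v}" "r \<in> X ` {u..v}"
      unfolding l_def r_def min_def max_def using uv by auto
    ultimately show "{l..r} \<subseteq> X ` {u..v}" by (rule connected_contains_Icc)
  qed
  define Y where "Y = the_inv_into {u..v} X"
  have YX: "Y (X s) = s" if "s \<in> {u..v}" for s
    unfolding Y_def using that injX by (simp add: the_inv_into_f_f)
  have Y: "Y x \<in> {u..v} \<and> X (Y x) = x" if "x \<in> {l..r}" for x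
    using that YX unfolding imX[symmetric] by auto
  have contY: "continuous_on {l..r} Y"
    using continuous_on_inv[OF contX compact_Icc, of Y] YX imX by auto
  define h where "h = (\<lambda>x. snd (f (Y x)))"
  have fY: "(x, h x) = f (Y x)" if "x \<in> {l..r}" for x
    using Y[OF that] unfolding h_def X_def by (simp add: prod_eq_iff)
  have conth: "continuous_on {l..r} h"
    unfolding h_def
    by (intro continuous_on_snd continuous_on_compose2[OF contf contY]) (use Y in auto)
  have graph: "graph_over h l r = f ` {u..v}"
  proof -
    have "graph_over h l r = f ` Y ` {l..r}"
      unfolding graph_over_def image_image using fY by (intro image_cong) auto
    also have "Y ` {l..r} = {u..v}" unfolding imX[symmetric] image_image using YX by simp
    finally show ?thesis .
  qed
  have "monotone_piece C l r h"
    unfolding monotone_piece_def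
  proof (intro conjI ballI)
    show "graph_over h l r \<subseteq> C" unfolding graph using reg(2) sub by blast
    fix x assume x: "x \<in> {l<..<r}"
    then have xlr: "x \<in> {l..r}" by auto
    have "Y x \<noteq> u" "Y x \<noteq> v" using Y[OF xlr] x unfolding l_def r_def by auto
    then have Yx: "u < Y x" "Y x < v" using Y[OF xlr] by auto
    then show "(x, h x) \<in> curve_interior C"
      unfolding fY[OF xlr] using uv by (intro inner_param_in_curve_interior[OF f]) auto
    let ?K = "f ` ({a..u} \<union> {v..b})"
    have "compact ?K"
      using uv by (intro compact_continuous_image continuous_on_subset[OF reg(3)] compact_Un) auto
    then have "open (- ?K)" by (simp add: compact_imp_closed open_Compl)
    moreover have "f (Y x) \<notin> ?K"
    proof
      assume "f (Y x) \<in> ?K"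
      then obtain s where s: "s \<in> {a..u} \<union> {v..b}" "f (Y x) = f s" by (elim imageE)
      then have "Y x = s" using Yx uv by (intro inj_onD[OF reg(1) s(2)]) auto
      then show False using s(1) Yx by auto
    qed
    moreover have "C \<inter> - ?K \<subseteq> graph_over h l r"
    proof
      fix p assume p: "p \<in> C \<inter> - ?K"
      then obtain s where s: "s \<in> {a..b}" "p = f s" unfolding reg(2)[symmetric] by blast
      then have "s \<in> {u..v}" using p by force
      then show "p \<in> graph_over h l r" unfolding graph s(2) by blast
    qed
    ultimately show "\<exists>W. open W \<and> (x, h x) \<in> W \<and> C \<inter> W \<subseteq> graph_over h l r"
      unfolding fY[OF xlr] by blast
  qed (use lr conth in auto)
  with graph show ?thesis by blast
qed

text \<open>
  The pieces are indexed by their left parameters, which are \<open>a\<close> and the at most \<open>t - 1\<close> parameters in \<open>V\<close>. A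
  curve with fewer than \<open>t\<close> pieces repeats one of them.
\<close>

lemma t_monotone_pieces:
  assumes C: "t_monotone t C" and "t \<ge> 1"
  shows "\<exists>lo hi ht. (\<forall>i<t. monotone_piece C (lo i) (hi i) (ht i)) \<and>
           C = (\<Union>i<t. graph_over (ht i) (lo i) (hi i))"
proof -
  obtain f a b where f: "param_of f a b C" using C unfolding t_monotone_def is_curve_def by blast
  then obtain f' where f': "\<forall>s\<in>{a..b}. (f has_vector_derivative f' s) (at s within {a..b})"
    and reg: "a < b" "inj_on f {a..b}" "f ` {a..b} = C"
    unfolding param_of_def regular_param_def by blast
  define V where "V = {s \<in> {a<..<b}. fst (f' s) = 0}"
  let ?P = "{p \<in> curve_interior C. vertical_tangent_at C p}"
  have P: "finite ?P" "card ?P \<le> t - 1" using C unfolding t_monotone_def by auto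
  have fV: "f ` V \<subseteq> ?P"
  proof
    fix p assume "p \<in> f ` V"
    then obtain s where s: "a < s" "s < b" "fst (f' s) = 0" "p = f s" unfolding V_def by auto
    have "vector_derivative f (at s within {a..b}) = f' s"
      using f' s by (intro vector_derivative_within_closed_interval) auto
    then have "vertical_tangent_at C p"
      unfolding vertical_tangent_at_def using f s
      by - (rule exI[of _ f], rule exI[of _ a], rule exI[of _ b], rule exI[of _ s], simp)
    then show "p \<in> ?P" using inner_param_in_curve_interior[OF f s(1,2)] s(4) by blast
  qed
  have injV: "inj_on f V" using reg(2) by (rule inj_on_subset) (auto simp: V_def)
  have finV: "finite V" using fV P(1) injV by (meson finite_imageD finite_subset)
  have cardV: "card V \<le> t - 1"
    using card_mono[OF P(1) fV] P(2) by (simp add: card_image[OF injV])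
  define U where "U = insert a V"
  define nxt where "nxt u = Min {w \<in> insert b V. u < w}" for u
  have U: "finite U" "U \<noteq> {}" "card U \<le> t" "U \<subseteq> {a..<b}"
    unfolding U_def using finV cardV \<open>t \<ge> 1\<close> reg(1)
    by (auto simp: card_insert_if V_def)
  have nxt: "u < nxt u \<and> nxt u \<le> b \<and> (\<forall>w\<in>V. u < w \<longrightarrow> nxt u \<le> w)" if "u \<in> U" for u
  proof -
    let ?M = "{w \<in> insert b V. u < w}"
    have fin: "finite ?M" using finV by auto
    have "b \<in> ?M" using that U by auto
    then have "nxt u \<in> ?M" unfolding nxt_def using Min_in[OF fin] by blast
    moreover have "nxt u \<le> w" if "w \<in> ?M" for w unfolding nxt_def using fin that by simp
    ultimately show ?thesis using \<open>b \<in> ?M\<close> by auto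
  qed
  have "\<exists>l r h. monotone_piece C l r h \<and> graph_over h l r = f ` {u..nxt u}" if u: "u \<in> U" for u
  proof (rule monotone_piece_of_param[OF f f'])
    show "a \<le> u" "u < nxt u" "nxt u \<le> b" using U nxt[OF u] u by auto
    show "\<forall>s\<in>{u<..<nxt u}. fst (f' s) \<noteq> 0"
    proof (intro ballI notI)
      fix s assume s: "s \<in> {u<..<nxt u}" "fst (f' s) = 0"
      then have "s \<in> V" unfolding V_def using U(4) u nxt[OF u] by auto
      then show False using nxt[OF u] s(1) by auto
    qed
  qed
  then have "\<forall>u. \<exists>l r h. u \<in> U \<longrightarrow> monotone_piece C l r h \<and> graph_over h l r = f ` {u..nxt u}"
    by blast
  then obtain l r h where
    "\<forall>u. u \<in> U \<longrightarrow> monotone_piece C (l u) (r u) (h u) \<and> graph_over (h u) (l u) (r u) = f ` {u..nxt u}"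
    unfolding choice_iff by blast
  then have lrh: "monotone_piece C (l u) (r u) (h u)" "graph_over (h u) (l u) (r u) = f ` {u..nxt u}"
    if "u \<in> U" for u using that by blast+
  have cover: "C = (\<Union>u\<in>U. f ` {u..nxt u})"
  proof
    show "(\<Union>u\<in>U. f ` {u..nxt u}) \<subseteq> C"
    proof (rule UN_least)
      fix u assume "u \<in> U"
      from lrh[OF this] show "f ` {u..nxt u} \<subseteq> C" unfolding monotone_piece_def by simp
    qed
    show "C \<subseteq> (\<Union>u\<in>U. f ` {u..nxt u})"
    proof
      fix p assume "p \<in> C"
      then obtain s where s: "s \<in> {a..b}" "p = f s" using reg(3) by blast
      let ?L = "{u \<in> U. u \<le> s}"
      have L: "finite ?L" "?L \<noteq> {}" using U(1) s unfolding U_def by auto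
      have m: "Max ?L \<in> ?L" by (rule Max_in[OF L])
      then have mU: "Max ?L \<in> U" by blast
      have "s \<le> nxt (Max ?L)"
      proof (rule ccontr)
        assume *: "\<not> s \<le> nxt (Max ?L)"
        have "b \<in> {w \<in> insert b V. Max ?L < w}" using subsetD[OF U(4) mU] by simp
        then have "nxt (Max ?L) \<in> {w \<in> insert b V. Max ?L < w}"
          unfolding nxt_def using finV by (intro Min_in) auto
        then have "nxt (Max ?L) \<in> ?L" using * s(1) unfolding U_def by auto
        then show False using Max_ge[OF L(1)] nxt[OF mU] by (meson linorder_not_le)
      qed
      then have "s \<in> {Max ?L..nxt (Max ?L)}" using m by simp
      then show "p \<in> (\<Union>u\<in>U. f ` {u..nxt u})" unfolding s(2) using mU by blast
    qed
  qed
  have "\<exists>e :: nat \<Rightarrow> real. e ` {..<t} = U"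
  proof -
    obtain e where e: "bij_betw e {0..<card U} U" using ex_bij_betw_nat_finite[OF U(1)] by blast
    obtain u0 where "u0 \<in> U" using U(2) by blast
    let ?e = "\<lambda>i. if i < card U then e i else u0"
    have "?e ` {..<t} = U"
    proof -
      have "?e ` {0..<card U} = U" using e unfolding bij_betw_def by (simp cong: image_cong_simp)
      moreover have "{0..<card U} \<subseteq> {..<t}" using U(3) by auto
      ultimately have "U \<subseteq> ?e ` {..<t}" by blast
      moreover have "?e i \<in> U" for i using e \<open>u0 \<in> U\<close> unfolding bij_betw_def by auto
      then have "?e ` {..<t} \<subseteq> U" by blast
      ultimately show ?thesis by blast
    qed
    then show ?thesis by blast
  qed
  then obtain e :: "nat \<Rightarrow> real" where e: "e ` {..<t} = U" by blast
  have eU: "e i \<in> U" if "i < t" for i using e that by blast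
  have "C = (\<Union>i<t. f ` {e i..nxt (e i)})" using cover unfolding e[symmetric] by simp
  also have "\<dots> = (\<Union>i<t. graph_over (h (e i)) (l (e i)) (r (e i)))"
    using lrh(2)[OF eU] by (intro SUP_cong) simp_all
  finally have "(\<forall>i<t. monotone_piece C (l (e i)) (r (e i)) (h (e i))) \<and>
      C = (\<Union>i<t. graph_over (h (e i)) (l (e i)) (r (e i)))"
    using lrh(1)[OF eU] by simp
  then show ?thesis
    by - (rule exI[of _ "\<lambda>i. l (e i)"], rule exI[of _ "\<lambda>i. r (e i)"], rule exI[of _ "\<lambda>i. h (e i)"])
qed

section \<open>Pieces of different curves cross at most once\<close>

text \<open>
  Suppose that \<open>g\<close> stays above \<open>f\<close> near a common point. A thin strip \<open>S\<close> above the graph of \<open>f\<close> is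
  connected and avoids \<open>A\<close>, so a homeomorphism that straightens \<open>A\<close> and \<open>B\<close> to the coordinate axes maps
  \<open>S\<close> to one side of the horizontal axis. But \<open>S\<close> contains points of \<open>B\<close> on both sides of the
  common point, and these are mapped to both halves of the vertical axis.
\<close>

lemma touching_imp_not_properly_cross:
  assumes A: "monotone_piece A l r f"
    and y: "l \<le> x" "x < y" "y < z" "z \<le> r"
    and g: "continuous_on {x..z} g" "graph_over g x z \<subseteq> B"
    and touch: "f y = g y" "\<And>w. \<lbrakk>x \<le> w; w \<le> z; w \<noteq> y\<rbrakk> \<Longrightarrow> f w < g w"
  shows "\<not> properly_cross_at A B (y, f y)"
proof
  let ?p = "(y, f y)"
  assume "properly_cross_at A B ?p"
  then obtain U and h k :: "real \<times> real \<Rightarrow> real \<times> real" where U: "open U" "?p \<in> U" and hk: "homeomorphism U (UNIV :: (real \<times> real) set) h k"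
    and hp: "h ?p = (0, 0)" and hA: "h ` (A \<inter> U) = UNIV \<times> {0}" and hB: "h ` (B \<inter> U) = {0} \<times> UNIV"
    unfolding properly_cross_at_def by blast
  have conth: "continuous_on U h" using hk by (simp add: homeomorphism_def)
  have injh: "inj_on h U" 
    by (rule inj_on_inverseI[of U k h]) (rule homeomorphism_apply1[OF hk])
  have contf: "continuous_on {x..z} f"
    using A y unfolding monotone_piece_def by (auto intro: continuous_on_subset)
  have "y \<in> {l<..<r}" using y by auto
  then obtain W where W: "open W" "?p \<in> W" "A \<inter> W \<subseteq> graph_over f l r"
    using A unfolding monotone_piece_def by blast
  have "open (U \<inter> W)" "?p \<in> U \<inter> W" using U W by auto
  then obtain P :: "real set" and Q :: "real set" where PQ: "open P" "open Q" "?p \<in> P \<times> Q" "P \<times> Q \<subseteq> U \<inter> W"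
    by (rule open_prod_elim)
  obtain \<eta> where \<eta>: "\<eta> > 0" "ball (f y) \<eta> \<subseteq> Q"
    using openE[OF PQ(2), of "f y"] PQ(3) by auto
  obtain \<eta>' where \<eta>': "\<eta>' > 0" "ball y \<eta>' \<subseteq> P"
    using openE[OF PQ(1), of y] PQ(3) by auto
  have yxz: "y \<in> {x..z}" using y by auto
  obtain d1 where d1: "d1 > 0" "\<And>w. w \<in> {x..z} \<Longrightarrow> dist w y \<le> d1 \<Longrightarrow> dist (f w) (f y) < \<eta>"
    by (rule continuous_onE[OF contf yxz \<eta>(1)]) (rule that)
  obtain d2 where d2: "d2 > 0" "\<And>w. w \<in> {x..z} \<Longrightarrow> dist w y \<le> d2 \<Longrightarrow> dist (g w) (g y) < \<eta>"
    by (rule continuous_onE[OF g(1) yxz \<eta>(1)]) (rule that)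
  define \<delta> where "\<delta> = Min {d1, d2, \<eta>', y - x, z - y}"
  have \<delta>: "\<delta> > 0" "\<delta> \<le> d1" "\<delta> \<le> d2" "\<delta> \<le> \<eta>'" "\<delta> \<le> y - x" "\<delta> \<le> z - y"
    unfolding \<delta>_def using d1(1) d2(1) \<eta>'(1) y by auto
  have near: "w \<in> {x..z} \<and> w \<in> P \<and> \<bar>f w - f y\<bar> < \<eta> \<and> \<bar>g w - f y\<bar> < \<eta>"
    if "\<bar>w - y\<bar> < \<delta>" for w
  proof -
    have w: "w \<in> {x..z}" using that \<delta> by auto
    moreover have "w \<in> P" using \<eta>'(2) that \<delta>(4) by (auto simp: dist_real_def subset_iff)
    moreover have "\<bar>f w - f y\<bar> < \<eta>" using d1(2)[OF w] that \<delta>(2) by (simp add: dist_real_def)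
    moreover have "\<bar>g w - f y\<bar> < \<eta>" using d2(2)[OF w] that \<delta>(3) touch(1) by (simp add: dist_real_def)
    ultimately show ?thesis by blast
  qed
  have inUW: "(w, v) \<in> U \<inter> W" if "\<bar>w - y\<bar> < \<delta>" "\<bar>v - f y\<bar> < \<eta>" for w v
  proof -
    have "v \<in> Q" using \<eta>(2) that(2) by (auto simp: dist_real_def subset_iff)
    then show ?thesis using PQ(4) near[OF that(1)] by auto
  qed
  define S where "S = {(w, v). \<bar>w - y\<bar> < \<delta> \<and> f w < v \<and> v < f y + \<eta>}"
  have S_UW: "S \<subseteq> U \<inter> W"
  proof
    fix q assume "q \<in> S"
    then obtain w v where q: "q = (w, v)" "\<bar>w - y\<bar> < \<delta>" "f w < v" "v < f y + \<eta>"
      unfolding S_def by auto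
    then show "q \<in> U \<inter> W" using inUW[of w v] near[of w] by auto
  qed
  have S_A: "S \<inter> A = {}"
  proof -
    have False if "q \<in> S" "q \<in> A" for q
    proof -
      have "q \<in> graph_over f l r" using that S_UW W(3) by blast
      then show False using that(1) unfolding S_def graph_over_def by auto
    qed
    then show ?thesis by blast
  qed
  have "connected S"
  proof -
    let ?\<phi> = "\<lambda>q. (fst q, f (fst q) + snd q * (f y + \<eta> - f (fst q)))"
    let ?D = "{y - \<delta><..<y + \<delta>} \<times> {0<..<1::real}"
    have "S = ?\<phi> ` ?D"
    proof
      show "?\<phi> ` ?D \<subseteq> S"
      proof
        fix q assume "q \<in> ?\<phi> ` ?D"
        then obtain w t where wt: "\<bar>w - y\<bar> < \<delta>" "0 < t" "t < 1"
          "q = (w, f w + t * (f y + \<eta> - f w))" by auto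
        have pos: "0 < f y + \<eta> - f w" using near[OF wt(1)] by auto
        have "t * (f y + \<eta> - f w) < 1 * (f y + \<eta> - f w)"
          using wt(3) pos by (rule mult_strict_right_mono)
        then have "f w + t * (f y + \<eta> - f w) < f y + \<eta>" by simp
        moreover have "f w < f w + t * (f y + \<eta> - f w)" using wt(2) pos by simp
        ultimately show "q \<in> S" unfolding S_def wt(4) using wt(1) by blast
      qed
      show "S \<subseteq> ?\<phi> ` ?D"
      proof
        fix q assume "q \<in> S"
        then obtain w v where q: "q = (w, v)" "\<bar>w - y\<bar> < \<delta>" "f w < v" "v < f y + \<eta>"
          unfolding S_def by auto
        have pos: "0 < f y + \<eta> - f w" using q by auto
        have "q = ?\<phi> (w, (v - f w) / (f y + \<eta> - f w))" using q(1) pos by simp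
        moreover have "(w, (v - f w) / (f y + \<eta> - f w)) \<in> ?D"
          using q pos by auto
        ultimately show "q \<in> ?\<phi> ` ?D" by blast
      qed
    qed
    moreover have "connected ?D" by (intro convex_connected convex_Times) auto
    moreover have "continuous_on ?D (\<lambda>q. f (fst q))"
    proof (rule continuous_on_compose2[OF contf])
      show "continuous_on ?D fst" by (intro continuous_on_fst continuous_on_id)
      show "fst ` ?D \<subseteq> {x..z}" using \<delta>(5,6) by auto
    qed
    then have "continuous_on ?D ?\<phi>" by (intro continuous_intros)
    ultimately show ?thesis by (simp only: connected_continuous_image)
  qed
  then have connS: "connected ((\<lambda>q. snd (h q)) ` S)"
    using S_UW by (intro connected_continuous_image continuous_on_snd continuous_on_subset[OF conth]) auto
  have nz: "0 \<notin> (\<lambda>q. snd (h q)) ` S"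
  proof
    assume "0 \<in> (\<lambda>q. snd (h q)) ` S"
    then obtain q where q: "q \<in> S" "snd (h q) = 0" by auto
    then have "h q \<in> h ` (A \<inter> U)" unfolding hA by (metis SigmaI UNIV_I insertI1 prod.collapse)
    then have "q \<in> A" using injh q(1) S_UW by (auto dest: inj_onD)
    then show False using q(1) S_A by blast
  qed
  define \<psi> where "\<psi> w = snd (h (w, g w))" for w
  let ?a = "y - \<delta> / 2" and ?b = "y + \<delta> / 2"
  have close: "\<bar>w - y\<bar> < \<delta>" if "w \<in> {?a..?b}" for w using that \<delta>(1) by auto
  have gU: "(w, g w) \<in> U \<inter> B" if "w \<in> {?a..?b}" for w
  proof -
    have "(w, g w) \<in> U" using inUW[OF close[OF that]] near[OF close[OF that]] by blast
    moreover have "(w, g w) \<in> graph_over g x z" using near[OF close[OF that]] by (simp add: mem_graph_over)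
    ultimately show ?thesis using g(2) by blast
  qed
  have h\<psi>: "h (w, g w) = (0, \<psi> w)" if "w \<in> {?a..?b}" for w
  proof -
    have "h (w, g w) \<in> h ` (B \<inter> U)" using gU[OF that] by blast
    then show ?thesis unfolding hB \<psi>_def by auto
  qed
  have "continuous_on {?a..?b} (\<lambda>w. h (w, g w))"
  proof (rule continuous_on_compose2[OF conth])
    have "{?a..?b} \<subseteq> {x..z}" using near[OF close] by blast
    then show "continuous_on {?a..?b} (\<lambda>w. (w, g w))"
      by (intro continuous_on_Pair continuous_on_id continuous_on_subset[OF g(1)])
  qed (use gU in blast)
  then have cont\<psi>: "continuous_on {?a..?b} \<psi>" unfolding \<psi>_def by (rule continuous_on_snd)
  have inj\<psi>: "inj_on \<psi> {?a..?b}"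
  proof (rule inj_onI)
    fix w w' assume w: "w \<in> {?a..?b}" "w' \<in> {?a..?b}" "\<psi> w = \<psi> w'"
    then have "h (w, g w) = h (w', g w')" using h\<psi> by simp
    then have "(w, g w) = (w', g w')" using injh gU[OF w(1)] gU[OF w(2)] by (auto dest: inj_onD)
    then show "w = w'" by simp
  qed
  have "\<psi> y = 0" unfolding \<psi>_def using hp touch(1) by simp
  then have sign: "(\<psi> ?a < 0 \<and> 0 < \<psi> ?b) \<or> (\<psi> ?b < 0 \<and> 0 < \<psi> ?a)"
    using continuous_inj_imp_mono[OF _ _ cont\<psi> inj\<psi>, of y] \<delta>(1) by auto
  have inS: "(w, g w) \<in> S" if "w = ?a \<or> w = ?b" for w
  proof -
    have w: "\<bar>w - y\<bar> < \<delta>" "w \<noteq> y" using that \<delta>(1) by auto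
    then show ?thesis unfolding S_def using near[OF w(1)] touch(2)[of w] by auto
  qed
  then have "\<psi> ?a \<in> (\<lambda>q. snd (h q)) ` S" "\<psi> ?b \<in> (\<lambda>q. snd (h q)) ` S"
    unfolding \<psi>_def by blast+
  then have "0 \<in> (\<lambda>q. snd (h q)) ` S"
    using connected_contains_Icc[OF connS] sign by (meson atLeastAtMost_iff less_imp_le subsetD)
  with nz show False by blast
qed

text \<open>
  The sign pattern forces a zero of the difference in \<open>[x, y]\<close> and one in \<open>[y, z]\<close>. As there is only
  one common point, both are \<open>y\<close>, and \<open>g\<close> touches \<open>f\<close> from above there.
\<close>

lemma pieces_no_return:
  assumes F: "simple_family F" "A \<in> F" "B \<in> F" "A \<noteq> B"
    and A: "monotone_piece A l r f" and B: "monotone_piece B l' r' g"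
    and x: "l \<le> x" "l' \<le> x" "x < y" "y < z" "z \<le> r" "z \<le> r'"
  shows "\<not> (f x \<le> g x \<and> g y \<le> f y \<and> f z \<le> g z)"
proof
  assume sg: "f x \<le> g x \<and> g y \<le> f y \<and> f z \<le> g z"
  note AB = mp[OF bspec[OF bspec[OF F(1)[unfolded simple_family_def] F(2)] F(3)] F(4)]
  have gA: "(w, f w) \<in> A" and gB: "(w, g w) \<in> B" if "x \<le> w" "w \<le> z" for w
    using A B x that unfolding monotone_piece_def by (auto simp: graph_over_def)
  have uniq: "w = w'" if "x \<le> w" "w \<le> z" "f w = g w" "x \<le> w'" "w' \<le> z" "f w' = g w'" for w w'
  proof -
    have "(w, f w) \<in> A \<inter> B" using gA[OF that(1,2)] gB[OF that(1,2)] that(3) by simp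
    moreover have "(w', f w') \<in> A \<inter> B" using gA[OF that(4,5)] gB[OF that(4,5)] that(6) by simp
    ultimately have "(w, f w) = (w', f w')" by (rule conjunct1[OF AB, rule_format])
    then show ?thesis by simp
  qed
  have "continuous_on {l..r} f" "continuous_on {l'..r'} g"
    using A B unfolding monotone_piece_def by simp_all
  then have cf: "continuous_on {x..z} f" and cg: "continuous_on {x..z} g"
    using x by (simp_all add: continuous_on_subset)
  have c: "continuous_on S (\<lambda>w. g w - f w)" if "S \<subseteq> {x..z}" for S
    by (intro continuous_on_diff continuous_on_subset[OF cf that] continuous_on_subset[OF cg that])
  have zero: "\<exists>w. u \<le> w \<and> w \<le> v \<and> f w = g w"
    if "x \<le> u" "u \<le> v" "v \<le> z" "(f u \<le> g u \<and> g v \<le> f v) \<or> (g u \<le> f u \<and> f v \<le> g v)" for u v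
  proof -
    have cuv: "continuous_on {u..v} (\<lambda>w. g w - f w)" using that by (intro c) auto
    have "\<exists>w. u \<le> w \<and> w \<le> v \<and> g w - f w = 0"
      using that(4) IVT'[OF _ _ that(2) cuv, of 0] IVT2'[OF _ _ that(2) cuv, of 0] by auto
    then show ?thesis by auto
  qed
  obtain w1 where w1: "x \<le> w1" "w1 \<le> y" "f w1 = g w1" using zero[of x y] sg x by auto
  obtain w2 where w2: "y \<le> w2" "w2 \<le> z" "f w2 = g w2" using zero[of y z] sg x by auto
  have "w1 = w2" using uniq[of w1 w2] w1 w2 x by auto
  then have fy: "f y = g y" using w1 w2 by auto
  have above: "f w < g w" if w: "x \<le> w" "w \<le> z" "w \<noteq> y" for w
  proof (rule ccontr)
    assume "\<not> f w < g w"
    then have le: "g w \<le> f w" by simp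
    show False
    proof (cases "w < y")
      case True
      then obtain w' where "x \<le> w'" "w' \<le> w" "f w' = g w'" using zero[of x w] sg w le by auto
      then show False using uniq[of w' y] fy True x w by auto
    next
      case False
      then obtain w' where "w \<le> w'" "w' \<le> z" "f w' = g w'" using zero[of w z] sg w le by auto
      then show False using uniq[of w' y] fy False x w by auto
    qed
  qed
  have "(y, f y) \<in> curve_interior A" using A x unfolding monotone_piece_def by auto
  moreover have "(y, f y) \<in> curve_interior B"
    using B x unfolding fy monotone_piece_def by auto
  ultimately have "properly_cross_at A B (y, f y)" using conjunct2[OF AB] by blast
  moreover have "graph_over g x z \<subseteq> B" using gB unfolding graph_over_def by auto
  ultimately show False
    using touching_imp_not_properly_cross[OF A x(1,3,4,5) cg _ fy above] by blast
qed

lemma pieces_cross_once: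
  assumes F: "simple_family F" "A \<in> F" "B \<in> F" "A \<noteq> B"
    and A: "monotone_piece A l r f" and B: "monotone_piece B l' r' g"
  shows "crosses_once l r f l' r' g"
  unfolding crosses_once_def
proof (intro allI impI)
  fix x y z assume "max l l' \<le> x \<and> x < y \<and> y < z \<and> z \<le> min r r'"
  then have x: "l \<le> x" "l' \<le> x" "x < y" "y < z" "z \<le> r" "z \<le> r'" by auto
  show "\<not> (f x \<le> g x \<and> g y \<le> f y \<and> f z \<le> g z) \<and> \<not> (g x \<le> f x \<and> f y \<le> g y \<and> g z \<le> f z)"
    using pieces_no_return[OF F A B x]
      pieces_no_return[OF F(1,3,2) F(4)[symmetric] B A x(2,1,3,4,6,5)] by blast
qed

section \<open>Disjoint subfamilies\<close>

lemma card_disjoint_pairs_le: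
  assumes "finite F"
  shows "card (disjoint_pairs F) \<le> card {(A, B). A \<in> F \<and> B \<in> F \<and> A \<inter> B = {}}"
proof -
  have "{(A, B). A \<in> F \<and> B \<in> F \<and> A \<inter> B = {}} \<subseteq> F \<times> F" by auto
  then have fin: "finite {(A, B). A \<in> F \<and> B \<in> F \<and> A \<inter> B = {}}"
    using assms by (meson finite_SigmaI finite_subset)
  have "disjoint_pairs F \<subseteq> (\<lambda>(A, B). {A, B}) ` {(A, B). A \<in> F \<and> B \<in> F \<and> A \<inter> B = {}}"
    unfolding disjoint_pairs_def by auto
  then show ?thesis using surj_card_le[OF fin] by blast
qed

text \<open>
  This bound turns any constant factor \<open>2 ^ (- i)\<close> into a power of \<open>\<epsilon>\<close>.
\<close>

lemma disjoint_pairs_density: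
  assumes F: "finite F" "card F = n" "n > 0" and ne: "{} \<notin> F"
    and dense: "\<epsilon> * (real n)\<^sup>2 \<le> card (disjoint_pairs F)"
  shows "\<epsilon> \<le> 1 / 2"
proof -
  have "disjoint_pairs F \<subseteq> {K. K \<subseteq> F \<and> card K = 2}"
    unfolding disjoint_pairs_def by (auto simp: card_insert_if)
  then have "card (disjoint_pairs F) \<le> card {K. K \<subseteq> F \<and> card K = 2}"
    using F(1) by (intro card_mono) auto
  also have "\<dots> = n choose 2" using n_subsets[OF F(1), of 2] F(2) by simp
  finally have "2 * card (disjoint_pairs F) \<le> n * (n - 1)"
    by (simp add: choose_two)
  also have "\<dots> \<le> n ^ 2" by (simp add: power2_eq_square)
  finally have "2 * real (card (disjoint_pairs F)) \<le> (real n)\<^sup>2"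
    by (metis of_nat_le_iff of_nat_mult of_nat_numeral of_nat_power)
  then have "2 * \<epsilon> * (real n)\<^sup>2 \<le> 1 * (real n)\<^sup>2" using dense by linarith
  then have "2 * \<epsilon> \<le> 1" using F(3) by (simp add: mult_le_cancel_right)
  then show ?thesis by simp
qed

theorem theorem1p4:
  fixes t :: nat
  assumes "t \<ge> 1"
  shows "\<exists>c::real. \<forall>(\<epsilon>::real) (n::nat) (F :: (real \<times> real) set set).
    \<epsilon> > 0 \<longrightarrow> n > 0 \<longrightarrow>
    finite F \<longrightarrow> card F = n \<longrightarrow> (\<forall>C\<in>F. t_monotone t C) \<longrightarrow> simple_family F \<longrightarrow>
    real (card (disjoint_pairs F)) \<ge> \<epsilon> * (real n)\<^sup>2 \<longrightarrow>
    (\<exists>F1 F2. F1 \<subseteq> F \<and> F2 \<subseteq> F \<and>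
       real (card F1) \<ge> \<epsilon> powr c * real n \<and> real (card F2) \<ge> \<epsilon> powr c * real n \<and>
       (\<forall>A\<in>F1. \<forall>B\<in>F2. A \<inter> B = {}))"
proof -
  let ?J = "{..<t} \<times> {..<t}"
  obtain m k where apart: "\<forall>(A :: (real \<times> real) set set) (B :: (real \<times> real) set set)
       lo1 hi1 ht1 lo2 hi2 ht2.
     finite A \<longrightarrow> finite B \<longrightarrow> pseudo_arcs A lo1 hi1 ht1 \<longrightarrow> pseudo_arcs B lo2 hi2 ht2 \<longrightarrow>
     certifiable m k A B (arcs_apart lo1 hi1 ht1 lo2 hi2 ht2)"
    using certifiable_arcs_apart by (elim exE)
  obtain m' k' where all: "\<forall>(A :: (real \<times> real) set set) (B :: (real \<times> real) set set) D.
     (\<forall>ij\<in>?J. certifiable m k A B (D ij)) \<longrightarrow> certifiable m' k' A B (\<lambda>a b. \<forall>ij\<in>?J. D ij a b)"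
    using certifiable_Ball[OF finite_cartesian_product[OF finite_lessThan finite_lessThan], of t t m k]
    by blast
  define s where "s = m' + 3 * k' + 1"
  \<comment> \<open>The three summands pay for \<open>\<epsilon> ^ (s + 1)\<close>, for its factor \<open>1 / 2 ^ (s + 1)\<close> and for the number of
    cells, the last two by means of \<open>\<epsilon> \<le> 1 / 2\<close>.\<close>
  define e where "e = (s + 1) + (s + 1) + (s + m' + 1)"
  have goal: "\<exists>F1 F2. F1 \<subseteq> F \<and> F2 \<subseteq> F \<and>
       real (card F1) \<ge> \<epsilon> powr real e * real n \<and> real (card F2) \<ge> \<epsilon> powr real e * real n \<and>
       (\<forall>A\<in>F1. \<forall>B\<in>F2. A \<inter> B = {})"
    if \<epsilon>: "\<epsilon> > 0" and n: "n > 0" and F: "finite F" "card F = n"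
      and mono: "\<forall>C\<in>F. t_monotone t C" and simple: "simple_family F"
      and dense: "real (card (disjoint_pairs F)) \<ge> \<epsilon> * (real n)\<^sup>2"
    for \<epsilon> :: real and n :: nat and F :: "(real \<times> real) set set"
  proof -
    have "\<forall>C. \<exists>lo hi ht. C \<in> F \<longrightarrow> (\<forall>i<t. monotone_piece C (lo i) (hi i) (ht i)) \<and>
           C = (\<Union>i<t. graph_over (ht i) (lo i) (hi i))"
      using t_monotone_pieces[OF _ \<open>t \<ge> 1\<close>] mono by blast
    then obtain lo hi ht where pieces:
      "\<forall>C. C \<in> F \<longrightarrow> (\<forall>i<t. monotone_piece C (lo C i) (hi C i) (ht C i)) \<and>
           C = (\<Union>i<t. graph_over (ht C i) (lo C i) (hi C i))"
      unfolding choice_iff by blast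
    have piece: "monotone_piece C (lo C i) (hi C i) (ht C i)" if "C \<in> F" "i < t" for C i
      using pieces that by blast
    have union: "C = (\<Union>i<t. graph_over (ht C i) (lo C i) (hi C i))" if "C \<in> F" for C
      using pieces[rule_format, OF that] by (rule conjunct2)
    define D where "D = (\<lambda>(i, j). arcs_apart (\<lambda>C. lo C i) (\<lambda>C. hi C i) (\<lambda>C. ht C i)
                                     (\<lambda>C. lo C j) (\<lambda>C. hi C j) (\<lambda>C. ht C j))"
    have once: "crosses_once (lo A i) (hi A i) (ht A i) (lo B j) (hi B j) (ht B j)"
      if "A \<in> F" "B \<in> F" "A \<noteq> B" "i < t" "j < t" for A B i j
      using pieces_cross_once[OF simple that(1-3) piece[OF that(1,4)] piece[OF that(2,5)]] .
    have arcs: "pseudo_arcs F (\<lambda>C. lo C i) (\<lambda>C. hi C i) (\<lambda>C. ht C i)" if "i < t" for i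
      unfolding pseudo_arcs_def using once that by blast
    have "\<forall>ij\<in>?J. certifiable m k F F (D ij)"
      using apart[rule_format, OF F(1) F(1) arcs arcs] unfolding D_def by auto
    then have cert: "certifiable m' k' F F (\<lambda>A B. \<forall>ij\<in>?J. D ij A B)" using all by simp
    have ne: "C \<noteq> {}" if "C \<in> F" for C
      using piece[OF that, of 0] \<open>t \<ge> 1\<close> unfolding monotone_piece_def graph_over_def by auto
    have D_iff: "(\<forall>ij\<in>?J. D ij A B) \<longleftrightarrow> A \<inter> B = {}" if AB: "A \<in> F" "B \<in> F" for A B
    proof
      assume disj: "A \<inter> B = {}"
      have "D (i, j) A B" if ij: "i < t" "j < t" for i j
        unfolding D_def prod.case
      proof (rule disjoint_imp_arcs_apart)
        note pA = piece[OF AB(1) ij(1)] and pB = piece[OF AB(2) ij(2)]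
        show "lo A i \<le> hi A i" "lo B j \<le> hi B j" "continuous_on {lo A i..hi A i} (ht A i)"
          "continuous_on {lo B j..hi B j} (ht B j)"
          using pA pB unfolding monotone_piece_def by auto
        fix x assume x: "lo A i \<le> x" "x \<le> hi A i" "lo B j \<le> x" "x \<le> hi B j"
        have "(x, ht A i x) \<in> A" "(x, ht B j x) \<in> B"
          using pA pB x unfolding monotone_piece_def by (auto simp: graph_over_def)
        then show "ht A i x \<noteq> ht B j x" using disj by auto
      qed
      then show "\<forall>ij\<in>?J. D ij A B" by auto
    next
      assume D: "\<forall>ij\<in>?J. D ij A B"
      \<comment> \<open>For \<open>A = B\<close> the pieces need not cross only once; but a piece is not strictly below itself.\<close>
      have "A \<noteq> B"
      proof
        assume "A = B"
        then have "D (0, 0) A A" using D \<open>t \<ge> 1\<close> by auto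
        moreover have "lo A 0 < hi A 0"
          using piece[OF AB(1), of 0] \<open>t \<ge> 1\<close> unfolding monotone_piece_def by auto
        ultimately show False
          unfolding D_def prod.case arcs_apart_def overlap_below_def by auto
      qed
      show "A \<inter> B = {}"
      proof (rule ccontr)
        assume "A \<inter> B \<noteq> {}"
        then obtain x v where "(x, v) \<in> A" "(x, v) \<in> B" by auto
        then obtain i j where ij: "i < t" "(x, v) \<in> graph_over (ht A i) (lo A i) (hi A i)"
          "j < t" "(x, v) \<in> graph_over (ht B j) (lo B j) (hi B j)"
          using union[OF AB(1)] union[OF AB(2)] by blast
        have "D (i, j) A B" using D ij by auto
        then have apart_ij: "arcs_apart (\<lambda>C. lo C i) (\<lambda>C. hi C i) (\<lambda>C. ht C i)
            (\<lambda>C. lo C j) (\<lambda>C. hi C j) (\<lambda>C. ht C j) A B"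
          unfolding D_def prod.case .
        have "ht A i x \<noteq> ht B j x"
          by (rule arcs_apart_imp_disjoint[OF _ apart_ij])
            (use once[OF AB \<open>A \<noteq> B\<close> ij(1,3)] ij(2,4) in \<open>simp_all add: mem_graph_over\<close>)
        then show False using ij(2,4) unfolding mem_graph_over by simp
      qed
    qed
    have "{(A, B). A \<in> F \<and> B \<in> F \<and> A \<inter> B = {}} =
        {(A, B). A \<in> F \<and> B \<in> F \<and> (\<forall>ij\<in>?J. D ij A B)}"
      using D_iff by auto
    then have "real (card (disjoint_pairs F)) \<le>
        real (card {(A, B). A \<in> F \<and> B \<in> F \<and> (\<forall>ij\<in>?J. D ij A B)})"
      using card_disjoint_pairs_le[OF F(1)] by simp
    then have dense': "\<epsilon> * card F * card F \<le>
        card {(A, B). A \<in> F \<and> B \<in> F \<and> (\<forall>ij\<in>?J. D ij A B)}"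
      using dense F(2) by (simp add: power2_eq_square mult.assoc)
    have Fne: "F \<noteq> {}" using F n by auto
    obtain F1 F2 where F12: "F1 \<subseteq> F" "F2 \<subseteq> F" "\<forall>A\<in>F1. \<forall>B\<in>F2. \<forall>ij\<in>?J. D ij A B"
      "(\<epsilon> / 2) ^ (s + 1) / 2 ^ (s + m' + 1) * card F \<le> card F1" "\<epsilon> / 8 * card F \<le> card F2"
      by (rule certifiable_dense_imp_biclique[OF F(1) F(1) Fne Fne cert \<epsilon> dense' s_def])
    have half: "\<epsilon> \<le> 1 / 2"
      using disjoint_pairs_density[OF F n _ dense] ne by blast
    have pow: "\<epsilon> ^ i \<le> (1 / 2) ^ i" for i using half \<epsilon> by (intro power_mono) auto
    have "\<epsilon> ^ e = \<epsilon> ^ (s + 1) * \<epsilon> ^ (s + 1) * \<epsilon> ^ (s + m' + 1)"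
      unfolding e_def by (simp add: power_add)
    also have "\<dots> \<le> \<epsilon> ^ (s + 1) * (1 / 2) ^ (s + 1) * (1 / 2) ^ (s + m' + 1)"
      using \<epsilon> by (intro mult_mono pow) auto
    also have "\<dots> = (\<epsilon> / 2) ^ (s + 1) / 2 ^ (s + m' + 1)"
      by (simp add: power_divide)
    finally have e1: "\<epsilon> ^ e \<le> (\<epsilon> / 2) ^ (s + 1) / 2 ^ (s + m' + 1)" .
    have "\<epsilon> ^ e \<le> \<epsilon> ^ 4"
      using half \<epsilon> unfolding e_def s_def by (intro power_decreasing) auto
    also have "\<dots> = \<epsilon> * \<epsilon> ^ 3" by (simp add: eval_nat_numeral)
    also have "\<dots> \<le> \<epsilon> * (1 / 2) ^ 3" using \<epsilon> by (intro mult_left_mono pow) auto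
    finally have e2: "\<epsilon> ^ e \<le> \<epsilon> / 8" by (simp add: eval_nat_numeral)
    have "\<epsilon> powr real e * real n \<le> card F1"
      using F12(4) mult_right_mono[OF e1, of "real n"] \<epsilon> F(2) by (simp add: powr_realpow)
    moreover have "\<epsilon> powr real e * real n \<le> card F2"
      using F12(5) mult_right_mono[OF e2, of "real n"] \<epsilon> F(2) by (simp add: powr_realpow)
    moreover have "\<forall>A\<in>F1. \<forall>B\<in>F2. A \<inter> B = {}"
      using F12(1-3) D_iff by blast
    ultimately show ?thesis using F12(1,2) by blast
  qed
  show ?thesis
    by (rule exI[of _ "real e"]) (use goal in blast)
qed

end
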